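(* Suppose that $\varphi:\mathbb{D}\to\mathbb{D}$ is a holomorphic function. The composition operator $C_\varphi$ is continuous on $\mathcal{Z}^{v_{\log}}$ if and only if $$\max\left\{\sup_{n\in\{0,1,2,\dots\}}\frac{(n+2)(n+1)\,\|J'_{\varphi'}(\varphi^n)\|_{\mathcal{Z}^{v_{\log}}}}{\|g_{n+2}\|_{\mathcal{Z}^{w_{\log}}}},\ \sup_{n\in\{1,2,3,\dots\}}\frac{(n+1)\,\|I'_{\varphi'}(\varphi^n)\|_{\mathcal{Z}^{v_{\log}}}}{\|g_{n+1}\|_{\mathcal{Z}^{v_{\log}}}}\right\}<\infty.$$
   Context: $\mathbb{D}$ is the open unit disk of $\mathbb{C}$ and $H(\mathbb{D})$ is the space of holomorphic functions on $\mathbb{D}$. The weights used are $v_{\log}(z)=(1-|z|)\log\left(\frac{2}{1-|z|}\right)$ and $w_{\log}(z)=\left[\log\log\left(\frac{4}{1-|z|^2}\right)\right]^{-1}$, $z\in\mathbb{D}$. For $v\in\{v_{\log},w_{\log}\}$, $\mathcal{Z}^v$ is the Banach space of all $f\in H(\mathbb{D})$ with $\sup_{z\in\mathbb{D}}v(z)|f''(z)|<\infty$, normed by $\|f\|_{\mathcal{Z}^v}=|f(0)|+|f'(0)|+\sup_{z\in\mathbb{D}}v(z)|f''(z)|$ (with value $+\infty$ if $f\notin\mathcal{Z}^v$). $C_\varphi(f)=f\circ\varphi$. For holomorphic $u:\mathbb{D}\to\mathbb{C}$ and $f\in H(\mathbb{D})$, define the holomorphic functions $I_u(f)(z)=\int_0^z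 f'(s)u(s)\,ds$, $J_u(f)(z)=\int_0^z f(s)u'(s)\,ds$, $I'_u(f)(z)=\int_0^z I_u(f)(s)\,ds$ and $J'_u(f)(z)=\int_0^z J_u(f)(s)\,ds$ (here the prime on $I'_u,J'_u$ is part of the name, not a derivative). In the claim $u=\varphi'$. $\varphi^n$ is the pointwise $n$-th power of $\varphi$ ($\varphi^0\equiv 1$), and $g_n(z)=z^n$. *)

theory Defs
  imports "HOL-Complex_Analysis.Complex_Analysis"
begin

text \<open>
  Functions on the unit disk are modelled as total functions of type complex to complex; every
  notion below depends only on their restriction to the disk.
\<close>

abbreviation unit_disk :: "complex set"
  where "unit_disk \<equiv> ball 0 1"

definition v_log :: "complex \<Rightarrow> real"
  where "v_log z = (1 - cmod z) * ln (2 / (1 - cmod z))"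

definition w_log :: "complex \<Rightarrow> real"
  where "w_log z = inverse (ln (ln (4 / (1 - (cmod z)\<^sup>2))))"

definition zygmund_space :: "(complex \<Rightarrow> real) \<Rightarrow> (complex \<Rightarrow> complex) set"
  where "zygmund_space v =
    {f. f holomorphic_on unit_disk \<and>
        bdd_above ((\<lambda>z. v z * cmod (deriv (deriv f) z)) ` unit_disk)}"

definition zygmund_norm :: "(complex \<Rightarrow> real) \<Rightarrow> (complex \<Rightarrow> complex) \<Rightarrow> ennreal"
  where "zygmund_norm v f =
    (if f \<in> zygmund_space v
     then ennreal (cmod (f 0) + cmod (deriv f 0)
                   + (SUP z\<in>unit_disk. v z * cmod (deriv (deriv f) z)))
     else \<infinity>)"

definition comp_op :: "(complex \<Rightarrow> complex) \<Rightarrow> (complex \<Rightarrow> complex) \<Rightarrow> (complex \<Rightarrow> complex)"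
  where "comp_op \<phi> f = f \<circ> \<phi>"

text \<open>
  Continuity of an operator on the space includes that it maps the space into itself. As elements
  of the space are only determined on the disk, the norm is a seminorm on total functions, and
  continuity is spelled out in terms of it.
\<close>

definition continuous_on_zygmund ::
    "(complex \<Rightarrow> real) \<Rightarrow> ((complex \<Rightarrow> complex) \<Rightarrow> (complex \<Rightarrow> complex)) \<Rightarrow> bool"
  where "continuous_on_zygmund v T \<longleftrightarrow>
    (\<forall>f\<in>zygmund_space v. T f \<in> zygmund_space v) \<and>
    (\<forall>f\<in>zygmund_space v. \<forall>e::real>0. \<exists>d::real>0. \<forall>g\<in>zygmund_space v.
       zygmund_norm v (\<lambda>z. g z - f z) < ennreal d \<longrightarrow>
       zygmund_norm v (\<lambda>z. T g z - T f z) < ennreal e)"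

text \<open>
  For holomorphic arguments on the disk the integrals from 0 to z are path-independent;
  they are taken along the straight segment.
\<close>

definition I_op :: "(complex \<Rightarrow> complex) \<Rightarrow> (complex \<Rightarrow> complex) \<Rightarrow> (complex \<Rightarrow> complex)"
  where "I_op u f z = contour_integral (linepath 0 z) (\<lambda>s. deriv f s * u s)"

definition J_op :: "(complex \<Rightarrow> complex) \<Rightarrow> (complex \<Rightarrow> complex) \<Rightarrow> (complex \<Rightarrow> complex)"
  where "J_op u f z = contour_integral (linepath 0 z) (\<lambda>s. f s * deriv u s)"

text \<open>The primes are part of the names; they do not denote derivatives.\<close>

definition I_op' :: "(complex \<Rightarrow> complex) \<Rightarrow> (complex \<Rightarrow> complex) \<Rightarrow> (complex \<Rightarrow> complex)"
  where "I_op' u f z = contour_integral (linepath 0 z) (I_op u f)"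

definition J_op' :: "(complex \<Rightarrow> complex) \<Rightarrow> (complex \<Rightarrow> complex) \<Rightarrow> (complex \<Rightarrow> complex)"
  where "J_op' u f z = contour_integral (linepath 0 z) (J_op u f)"

end

theory Submission
  imports Defs
begin

text \<open>
  The chain rule splits the second derivative of a composition as
  \<open>(f \<circ> \<phi>)'' = f''(\<phi>) * \<phi>'\<^sup>2 + f'(\<phi>) * \<phi>''\<close>. For \<open>f\<close> in the unit ball of the space, \<open>f''\<close> is bounded by
  \<open>1 / v_log\<close>, and integrating this along radii bounds \<open>f'\<close> by a constant times \<open>1 / w_log\<close>
  (\<open>deriv_growth\<close>). Continuity is therefore equivalent to the two pointwise conditions
  \<^item> \<open>v_log z * cmod (\<phi>'' z) \<le> K * w_log (\<phi> z)\<close>,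
  \<^item> \<open>v_log z * (cmod (\<phi>' z))\<^sup>2 \<le> K * v_log (\<phi> z)\<close>.

  They suffice by the growth estimates (\<open>comp_op_bounded\<close>). They are necessary because for each point \<open>b\<close> of
  the disk there are functions of uniformly bounded norm that realise the extreme growth at \<open>b\<close>: one with
  \<open>f'(b) = 0\<close> and \<open>f''(b)\<close> of size \<open>1 / v_log b\<close> (\<open>test_function_critical\<close>), one with \<open>f'(b) = 1 / w_log b\<close>
  (\<open>test_function_loglog\<close>). Taking \<open>b = \<phi> z\<close>, the first gives the second condition, after which the other
  gives the first condition.

  The two suprema express the same conditions tested on monomials. The second derivatives of the integral
  operators applied to \<open>\<phi> ^ n\<close> are \<open>\<phi> ^ n * \<phi>''\<close> and \<open>n * \<phi> ^ (n - 1) * \<phi>'\<^sup>2\<close>, while the norms in the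
  denominators are, up to the matching factors and shift of the exponent, weighted suprema of \<open>cmod z ^ n\<close>. Both weights vary so slowly that every point of the disk
  nearly maximises the weighted modulus of some monomial (\<open>moderate_weight_power_le\<close>), so the bounds for all \<open>n\<close>
  together amount to a bound by the weight itself (\<open>power_bounds_iff_weight_bound\<close>).
\<close>

section \<open>The two weights\<close>

lemma ln_4_gt_1: "1 < ln (4::real)"
proof -
  have "exp 1 < (4::real)" using exp_le by linarith
  then show ?thesis by (metis exp_gt_zero ln_exp ln_less_cancel_iff zero_less_numeral)
qed

text \<open>
  Comparing logarithms of unordered arguments costs an error, and here the error
  \<open>q / p\<close> is linear in the ratio and can be absorbed into a ratio of distances to the boundary.
\<close>

lemma ln_le_add_ratio:
  fixes a p q :: real
  assumes "0 < a" "0 < p" "0 < q"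
  shows "ln (a / p) \<le> ln (a / q) + q / p"
proof -
  have "ln (q / p) \<le> q / p - 1" using assms by (intro ln_le_minus_one) simp
  moreover have "ln (a / p) = ln (a / q) + ln (q / p)" using assms by (simp add: ln_div)
  ultimately show ?thesis by linarith
qed

lemma v_log_pos: "z \<in> unit_disk \<Longrightarrow> 0 < v_log z"
  by (auto simp: v_log_def intro!: mult_pos_pos ln_gt_zero order_less_le_trans[OF _ norm_ge_zero])

lemma v_log_nonneg: "z \<in> unit_disk \<Longrightarrow> 0 \<le> v_log z"
  using v_log_pos less_imp_le by blast

lemma ln_4_le_ln:
  assumes "z \<in> unit_disk"
  shows "ln 4 \<le> ln (4 / (1 - (cmod z)\<^sup>2))"
proof -
  have "(cmod z)\<^sup>2 < 1" using assms by (simp add: abs_square_less_1)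
  then show ?thesis by (subst ln_le_cancel_iff) (auto simp: field_simps)
qed

lemma ln_ln_4_le_ln_ln:
  assumes "z \<in> unit_disk"
  shows "ln (ln 4) \<le> ln (ln (4 / (1 - (cmod z)\<^sup>2)))"
  using ln_4_le_ln[OF assms] ln_4_gt_1 by (subst ln_le_cancel_iff) auto

lemma ln_ln_4_pos: "0 < ln (ln (4::real))"
  using ln_4_gt_1 by simp

lemma w_log_pos: "z \<in> unit_disk \<Longrightarrow> 0 < w_log z"
  using order_less_le_trans[OF ln_ln_4_pos ln_ln_4_le_ln_ln] by (simp add: w_log_def)

text \<open>
  The regularity shared by both weights: a change of the distance to the boundary by a factor
  \<open>x\<close> changes the weight by at most a constant times \<open>1 + x\<close>. It says at once that the weight is almost
  decreasing in \<open>cmod z\<close> and that it decays no faster than linearly near the boundary.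
\<close>

definition moderate_weight :: "(complex \<Rightarrow> real) \<Rightarrow> bool"
  where "moderate_weight \<mu> \<longleftrightarrow> (\<forall>z\<in>unit_disk. 0 < \<mu> z) \<and>
    (\<exists>D>0. \<forall>s\<in>unit_disk. \<forall>b\<in>unit_disk.
       \<mu> s \<le> D * (1 + (1 - cmod s) / (1 - cmod b)) * \<mu> b)"

text \<open>
  The error \<open>q / p\<close> made in comparing the logarithms is multiplied by \<open>p\<close>, and the remaining \<open>q\<close> is
  absorbed because the logarithm in \<open>v_log\<close> is at least \<open>ln 2\<close>.
\<close>

lemma moderate_weight_v_log: "moderate_weight v_log"
proof -
  have "v_log s \<le> 1 / ln 2 * (1 + (1 - cmod s) / (1 - cmod b)) * v_log b"
    if s: "s \<in> unit_disk" and b: "b \<in> unit_disk" for s b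
  proof -
    define p q where "p = 1 - cmod s" and "q = 1 - cmod b"
    have pq: "0 < p" "0 < q" "q \<le> 1" using s b by (auto simp: p_def q_def)
    have l2: "ln 2 \<le> ln (2 / q)" using pq by (subst ln_le_cancel_iff) (auto simp: field_simps)
    have "ln 2 > (0::real)" "ln 2 < (1::real)" using ln_2_less_1 by auto
    have "p * ln (2 / p) \<le> p * (ln (2 / q) + q / p)"
      using ln_le_add_ratio[of 2 p q] pq by (intro mult_left_mono) auto
    also have "\<dots> = p * ln (2 / q) + q * 1" using pq by (simp add: field_simps)
    also have "\<dots> \<le> p * (ln (2 / q) / ln 2) + q * (ln (2 / q) / ln 2)"
    proof (intro add_mono mult_left_mono)
      have "ln (2 / q) * ln 2 \<le> ln (2 / q) * 1"
        using order_trans[OF less_imp_le[OF \<open>ln 2 > 0\<close>] l2] \<open>ln 2 < 1\<close>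
        by (intro mult_left_mono) auto
      then show "ln (2 / q) \<le> ln (2 / q) / ln 2" using \<open>ln 2 > 0\<close> by (simp add: field_simps)
      show "1 \<le> ln (2 / q) / ln 2" using l2 \<open>ln 2 > 0\<close> by simp
    qed (use pq in auto)
    also have "\<dots> = 1 / ln 2 * (1 + p / q) * (q * ln (2 / q))"
      using pq by (simp add: field_simps)
    finally show ?thesis by (simp add: v_log_def p_def q_def)
  qed
  moreover have "(0::real) < 1 / ln 2" by simp
  ultimately show ?thesis unfolding moderate_weight_def using v_log_pos by blast
qed

text \<open>
  The reciprocal of \<open>w_log\<close> is compared logarithm by logarithm. The additive errors of the inner and the
  outer logarithm turn into factors since these are bounded below by \<open>ln 4 > 1\<close> and \<open>ln (ln 4) > 0\<close>.
\<close>

lemma moderate_weight_w_log: "moderate_weight w_log"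
proof -
  define c where "c = ln (ln (4::real))"
  have c: "0 < c" using ln_ln_4_pos by (simp add: c_def)
  have "w_log s \<le> (1 + 2 / c) * (1 + (1 - cmod s) / (1 - cmod b)) * w_log b"
    if s: "s \<in> unit_disk" and b: "b \<in> unit_disk" for s b
  proof -
    define P Q where "P = 1 - (cmod s)\<^sup>2" and "Q = 1 - (cmod b)\<^sup>2"
    define x where "x = (1 - cmod s) / (1 - cmod b)"
    have PQ: "0 < P" "0 < Q" using s b by (auto simp: P_def Q_def abs_square_less_1)
    have x: "0 < x" using s b by (simp add: x_def)
    have LP: "ln 4 \<le> ln (4 / P)" and LQ: "ln 4 \<le> ln (4 / Q)"
      and llP: "c \<le> ln (ln (4 / P))" and llQ: "c \<le> ln (ln (4 / Q))"
      using ln_4_le_ln[OF s] ln_4_le_ln[OF b] ln_ln_4_le_ln_ln[OF s] ln_ln_4_le_ln_ln[OF b]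
      by (simp_all add: P_def Q_def c_def)
    have "P / Q = x * ((1 + cmod s) / (1 + cmod b))"
      by (simp add: P_def Q_def x_def power2_eq_square square_diff_one_factored field_simps)
    also have "\<dots> \<le> x * 2"
    proof (intro mult_left_mono)
      have "cmod s < 1" using s by simp
      then have "1 + cmod s \<le> 2 * 1 + 2 * cmod b" using norm_ge_zero[of b] by argo
      moreover have "0 < 1 + cmod b" using norm_ge_zero[of b] by linarith
      ultimately show "(1 + cmod s) / (1 + cmod b) \<le> 2" by (simp add: field_simps)
    qed (use x in simp)
    finally have PQx: "P / Q \<le> 2 * x" by simp
    have "ln (4 / Q) \<le> ln (4 / P) + P / Q"
      using ln_le_add_ratio[of 4 Q P] PQ by simp
    also have "P / Q \<le> P / Q * ln (4 / P)"
      using mult_left_mono[OF order_trans[OF less_imp_le[OF ln_4_gt_1] LP], of "P / Q"] PQ by simp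
    finally have "ln (4 / Q) \<le> ln (4 / P) * (1 + P / Q)" by (simp add: algebra_simps)
    then have "ln (ln (4 / Q)) \<le> ln (ln (4 / P) * (1 + P / Q))"
      using LQ ln_4_gt_1 by (subst ln_le_cancel_iff) auto
    also have "\<dots> = ln (ln (4 / P)) + ln (1 + P / Q)"
    proof (rule ln_mult_pos)
      show "0 < ln (4 / P)" using LP ln_4_gt_1 by linarith
      show "0 < 1 + P / Q" using PQ by (simp add: add_pos_pos)
    qed
    also have "ln (1 + P / Q) \<le> P / Q" using PQ by (intro ln_add_one_self_le_self) simp
    also have "\<dots> \<le> 2 * x" by (fact PQx)
    also have "\<dots> \<le> 2 * x * (ln (ln (4 / P)) / c)"
      using mult_left_mono[of 1 "ln (ln (4 / P)) / c" "2 * x"] llP c x by simp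
    finally have "ln (ln (4 / Q)) \<le> ln (ln (4 / P)) * (1 + 2 * x / c)"
      by (simp add: field_simps)
    also have "\<dots> \<le> ln (ln (4 / P)) * ((1 + 2 / c) * (1 + x))"
      using llP c x by (intro mult_left_mono) (auto simp: field_simps)
    finally have "1 / ln (ln (4 / P)) \<le> (1 + 2 / c) * (1 + x) * (1 / ln (ln (4 / Q)))"
      using llP llQ c by (simp add: field_simps)
    then show ?thesis by (simp add: w_log_def P_def Q_def x_def inverse_eq_divide)
  qed
  moreover have "0 < 1 + 2 / c" using c by (simp add: add_pos_pos)
  ultimately show ?thesis unfolding moderate_weight_def using w_log_pos by blast
qed

definition power_sup :: "(complex \<Rightarrow> real) \<Rightarrow> nat \<Rightarrow> real"
  where "power_sup \<mu> m = (SUP z\<in>unit_disk. \<mu> z * cmod z ^ m)"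

text \<open>
  For every \<open>b\<close> some power \<open>z ^ m\<close> has weighted supremum comparable to the value of the weighted
  power at \<open>b\<close>, uniformly in \<open>b\<close>. The right exponent is \<open>m \<approx> 1 / (1 - cmod b)\<close>: then \<open>cmod b ^ m\<close> is
  bounded below, and at a point \<open>s\<close> whose distance to the boundary is \<open>x\<close> times that of \<open>b\<close> the power is of
  order \<open>exp (- x)\<close>, which beats the growth \<open>1 + x\<close> allowed by moderateness.
\<close>

lemma moderate_weight_power_le:
  assumes "moderate_weight \<mu>"
  obtains C where "0 < C" 
    "\<And>b. b \<in> unit_disk \<Longrightarrow> \<exists>m. \<forall>s\<in>unit_disk. \<mu> s * cmod s ^ m \<le> C * (\<mu> b * cmod b ^ m)"
proof -
  from assms obtain D where D: "0 < D" and pos: "\<And>z. z \<in> unit_disk \<Longrightarrow> 0 < \<mu> z"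
    and mod: "\<And>s b. s \<in> unit_disk \<Longrightarrow> b \<in> unit_disk \<Longrightarrow>
       \<mu> s \<le> D * (1 + (1 - cmod s) / (1 - cmod b)) * \<mu> b"
    unfolding moderate_weight_def by blast
  have "\<exists>m. \<forall>s\<in>unit_disk. \<mu> s * cmod s ^ m \<le> D * exp 2 * exp 1 * (\<mu> b * cmod b ^ m)" 
    if b: "b \<in> unit_disk" for b
  proof -
    define r where "r = cmod b"
    have r: "0 \<le> r" "r < 1" using b by (auto simp: r_def)
    \<comment> \<open>\<open>r / (1 - r) = 1 / (1 - r) - 1\<close>; the shift by one makes \<open>m = 0\<close> for \<open>b = 0\<close>, where \<open>r ^ m\<close>
        would otherwise vanish.\<close>
    define m where "m = nat \<lfloor>r / (1 - r)\<rfloor>"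
    have "real m \<le> r / (1 - r)" "r / (1 - r) < real m + 1"
      using r by (auto simp: m_def)
    then have m: "real m * (1 - r) \<le> r" "r < (real m + 1) * (1 - r)"
      using r by (simp_all add: field_simps)
    have rm: "1 \<le> exp 1 * r ^ m"
    proof (cases "r = 0")
      case True
      then show ?thesis by (simp add: m_def)
    next
      case False
      with r have "0 < r" by simp
      have "(1 / r) ^ m \<le> exp (1 / r - 1) ^ m"
        using exp_ge_add_one_self[of "1 / r - 1"] \<open>0 < r\<close> by (intro power_mono) auto
      also have "\<dots> = exp (real m * (1 / r - 1))" by (simp add: exp_of_nat_mult)
      also have "\<dots> \<le> exp 1" using m(1) \<open>0 < r\<close> by (simp add: field_simps)
      finally show ?thesis using \<open>0 < r\<close> by (simp add: field_simps power_one_over)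
    qed
    have "\<mu> s * cmod s ^ m \<le> D * exp 2 * exp 1 * (\<mu> b * r ^ m)" if s: "s \<in> unit_disk" for s
    proof -
      define x where "x = (1 - cmod s) / (1 - r)"
      have x: "0 < x" using s r by (simp add: x_def)
      have "cmod s ^ m \<le> exp (cmod s - 1) ^ m"
        using exp_ge_add_one_self[of "cmod s - 1"] by (intro power_mono) auto
      also have "\<dots> = exp (real m * (cmod s - 1))" by (simp add: exp_of_nat_mult)
      also have "real m * (cmod s - 1) \<le> 2 - x"
      proof -
        have "1 / (1 - r) \<le> real m + 2" using m r by (simp add: field_simps)
        then have "1 / (1 - r) * (1 - cmod s) \<le> (real m + 2) * (1 - cmod s)"
          using s by (intro mult_right_mono) auto
        then have "x \<le> real m * (1 - cmod s) + 2 * (1 - cmod s)"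
          by (simp add: x_def distrib_right)
        also have "\<dots> \<le> real m * (1 - cmod s) + 2" by simp
        finally show ?thesis by (simp add: algebra_simps)
      qed
      finally have sm: "cmod s ^ m \<le> exp 2 * exp (- x)" by (simp flip: exp_add)
      have "(1 + x) * exp (- x) \<le> exp x * exp (- x)"
        by (intro mult_right_mono) auto
      then have xe: "(1 + x) * exp (- x) \<le> 1" by (simp flip: exp_add)
      have "\<mu> s * cmod s ^ m \<le> (D * (1 + x) * \<mu> b) * (exp 2 * exp (- x))"
        using mod[OF s b] sm D x pos[OF b] by (intro mult_mono) (auto simp: x_def r_def)
      also have "\<dots> = D * exp 2 * \<mu> b * ((1 + x) * exp (- x))" by (simp add: algebra_simps)
      also have "\<dots> \<le> D * exp 2 * \<mu> b * (exp 1 * r ^ m)"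
        using xe rm D pos[OF b] by (intro mult_left_mono) auto
      finally show ?thesis by (simp add: algebra_simps)
    qed
    then show ?thesis unfolding r_def by blast
  qed
  moreover have "0 < D * exp 2 * exp 1" using D by simp
  ultimately show thesis using that by blast
qed

lemma moderate_weight_bdd:
  assumes "moderate_weight \<mu>"
  shows "bdd_above ((\<lambda>z. \<mu> z * cmod z ^ m) ` unit_disk)"
proof -
  from assms obtain D where D: "0 < D" and pos: "\<And>z. z \<in> unit_disk \<Longrightarrow> 0 < \<mu> z"
    and mod: "\<And>s b. s \<in> unit_disk \<Longrightarrow> b \<in> unit_disk \<Longrightarrow>
       \<mu> s \<le> D * (1 + (1 - cmod s) / (1 - cmod b)) * \<mu> b"
    unfolding moderate_weight_def by blast
  have "\<mu> z * cmod z ^ m \<le> D * 2 * \<mu> 0" if z: "z \<in> unit_disk" for z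
  proof -
    have "\<mu> z * cmod z ^ m \<le> \<mu> z * 1"
      using z pos[OF z] by (intro mult_left_mono power_le_one) auto
    also have "\<mu> z \<le> D * (2 - cmod z) * \<mu> 0" using mod[OF z, of 0] by simp
    also have "\<dots> \<le> D * 2 * \<mu> 0"
      using D pos[of 0] by (intro mult_right_mono mult_left_mono) auto
    finally show ?thesis by simp
  qed
  then show ?thesis by (auto intro!: bdd_aboveI)
qed

lemma power_sup_upper:
  assumes "moderate_weight \<mu>" "z \<in> unit_disk"
  shows "\<mu> z * cmod z ^ m \<le> power_sup \<mu> m"
  unfolding power_sup_def using moderate_weight_bdd[OF assms(1)] assms(2) by (intro cSUP_upper) auto

lemma power_sup_pos:
  assumes "moderate_weight \<mu>"
  shows "0 < power_sup \<mu> m"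
proof -
  have "0 < \<mu> (1/2) * cmod (1/2) ^ m" using assms by (simp add: moderate_weight_def norm_divide)
  also have "\<dots> \<le> power_sup \<mu> m" by (rule power_sup_upper[OF assms]) (simp add: norm_divide)
  finally show ?thesis .
qed

text \<open>
  Testing on monomials loses nothing. If \<open>H\<close> is controlled by the weight along \<open>\<phi>\<close>, multiply by
  \<open>cmod (\<phi> z) ^ m\<close>. Conversely, at a given \<open>z\<close> use the exponent adapted to the point \<open>\<phi> z\<close>, for which
  the supremum is attained at \<open>\<phi> z\<close> up to a constant, and cancel the power.
\<close>

proposition power_bounds_iff_weight_bound:
  assumes \<mu>: "moderate_weight \<mu>" and \<phi>: "\<And>z. z \<in> unit_disk \<Longrightarrow> \<phi> z \<in> unit_disk"
    and H: "\<And>z. z \<in> unit_disk \<Longrightarrow> 0 \<le> H z"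
  shows "(\<exists>K\<ge>0. \<forall>m. \<forall>z\<in>unit_disk. H z * cmod (\<phi> z) ^ m \<le> K * power_sup \<mu> m) \<longleftrightarrow>
         (\<exists>K\<ge>0. \<forall>z\<in>unit_disk. H z \<le> K * \<mu> (\<phi> z))"
proof
  assume "\<exists>K\<ge>0. \<forall>m. \<forall>z\<in>unit_disk. H z * cmod (\<phi> z) ^ m \<le> K * power_sup \<mu> m"
  then obtain K where "0 \<le> K"
    and K: "\<And>m z. z \<in> unit_disk \<Longrightarrow> H z * cmod (\<phi> z) ^ m \<le> K * power_sup \<mu> m" by blast
  obtain C where "0 < C" and C: "\<And>b. b \<in> unit_disk \<Longrightarrow>
      \<exists>m. \<forall>s\<in>unit_disk. \<mu> s * cmod s ^ m \<le> C * (\<mu> b * cmod b ^ m)"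
    using moderate_weight_power_le[OF \<mu>] by metis
  have "H z \<le> K * C * \<mu> (\<phi> z)" if z: "z \<in> unit_disk" for z
  proof -
    obtain m where m: "\<And>s. s \<in> unit_disk \<Longrightarrow> \<mu> s * cmod s ^ m \<le> C * (\<mu> (\<phi> z) * cmod (\<phi> z) ^ m)"
      using C[OF \<phi>[OF z]] by blast
    have sup: "power_sup \<mu> m \<le> C * (\<mu> (\<phi> z) * cmod (\<phi> z) ^ m)"
      unfolding power_sup_def using m by (intro cSUP_least) auto
    with power_sup_pos[OF \<mu>, of m] \<open>0 < C\<close> have "0 < \<mu> (\<phi> z) * cmod (\<phi> z) ^ m"
      by (metis order_less_le_trans zero_less_mult_pos)
    moreover have "0 < \<mu> (\<phi> z)" using \<mu> \<phi>[OF z] by (simp add: moderate_weight_def)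
    ultimately have "0 < cmod (\<phi> z) ^ m" by (metis zero_less_mult_pos)
    have "H z * cmod (\<phi> z) ^ m \<le> K * (C * (\<mu> (\<phi> z) * cmod (\<phi> z) ^ m))"
      using K[OF z, of m] mult_left_mono[OF sup \<open>0 \<le> K\<close>] by linarith
    then show ?thesis
      using \<open>0 < cmod (\<phi> z) ^ m\<close> by (simp flip: mult.assoc)
  qed
  with \<open>0 \<le> K\<close> \<open>0 < C\<close> show "\<exists>K\<ge>0. \<forall>z\<in>unit_disk. H z \<le> K * \<mu> (\<phi> z)"
    by (intro exI[of _ "K * C"]) auto
next
  assume "\<exists>K\<ge>0. \<forall>z\<in>unit_disk. H z \<le> K * \<mu> (\<phi> z)"
  then obtain K where "0 \<le> K" and K: "\<And>z. z \<in> unit_disk \<Longrightarrow> H z \<le> K * \<mu> (\<phi> z)" by blast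
  have "H z * cmod (\<phi> z) ^ m \<le> K * power_sup \<mu> m" if z: "z \<in> unit_disk" for m z
  proof -
    have "H z * cmod (\<phi> z) ^ m \<le> K * \<mu> (\<phi> z) * cmod (\<phi> z) ^ m"
      using K[OF z] by (intro mult_right_mono) auto
    also have "\<dots> \<le> K * power_sup \<mu> m"
      using mult_left_mono[OF power_sup_upper[OF \<mu> \<phi>[OF z], of m] \<open>0 \<le> K\<close>]
      by (simp add: mult.assoc)
    finally show ?thesis .
  qed
  with \<open>0 \<le> K\<close> show "\<exists>K\<ge>0. \<forall>m. \<forall>z\<in>unit_disk. H z * cmod (\<phi> z) ^ m \<le> K * power_sup \<mu> m"
    by blast
qed

section \<open>The norm and second derivatives\<close>

text \<open>
  The pointwise form in which the norm is used throughout; membership in the space is part of the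
  right-hand side because the norm is infinite elsewhere.
\<close>

lemma zygmund_norm_le_iff:
  assumes "\<And>z. z \<in> unit_disk \<Longrightarrow> 0 \<le> v z" and "0 \<le> M"
  shows "zygmund_norm v f \<le> ennreal M \<longleftrightarrow>
    f holomorphic_on unit_disk \<and>
    (\<forall>z\<in>unit_disk. cmod (f 0) + cmod (deriv f 0) + v z * cmod (deriv (deriv f) z) \<le> M)"
proof (cases "f \<in> zygmund_space v")
  case True
  let ?g = "\<lambda>z. v z * cmod (deriv (deriv f) z)"
  have bdd: "bdd_above (?g ` unit_disk)" and "f holomorphic_on unit_disk"
    using True by (auto simp: zygmund_space_def)
  have "zygmund_norm v f \<le> ennreal M \<longleftrightarrow>
      cmod (f 0) + cmod (deriv f 0) + (SUP z\<in>unit_disk. ?g z) \<le> M"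
    using True \<open>0 \<le> M\<close> by (simp add: zygmund_norm_def ennreal_le_iff)
  also have "\<dots> \<longleftrightarrow> (SUP z\<in>unit_disk. ?g z) \<le> M - cmod (f 0) - cmod (deriv f 0)" by linarith
  also have "\<dots> \<longleftrightarrow> (\<forall>z\<in>unit_disk. ?g z \<le> M - cmod (f 0) - cmod (deriv f 0))"
    using bdd by (subst cSUP_le_iff) auto
  also have "\<dots> \<longleftrightarrow> (\<forall>z\<in>unit_disk. cmod (f 0) + cmod (deriv f 0) + ?g z \<le> M)"
    by (intro ball_cong refl) linarith
  finally show ?thesis using \<open>f holomorphic_on unit_disk\<close> by simp
next
  case False
  have bdd: "bdd_above ((\<lambda>z. v z * cmod (deriv (deriv f) z)) ` unit_disk)"
    if "\<forall>z\<in>unit_disk. cmod (f 0) + cmod (deriv f 0) + v z * cmod (deriv (deriv f) z) \<le> M"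
  proof (rule bdd_aboveI2)
    fix z assume "z \<in> unit_disk"
    with that have "cmod (f 0) + cmod (deriv f 0) + v z * cmod (deriv (deriv f) z) \<le> M" by blast
    moreover have "0 \<le> cmod (f 0)" "0 \<le> cmod (deriv f 0)" by auto
    ultimately show "v z * cmod (deriv (deriv f) z) \<le> M" by linarith
  qed
  have "\<not> (f holomorphic_on unit_disk \<and>
      (\<forall>z\<in>unit_disk. cmod (f 0) + cmod (deriv f 0) + v z * cmod (deriv (deriv f) z) \<le> M))"
    (is "\<not> (_ \<and> ?bound)")
  proof
    assume "f holomorphic_on unit_disk \<and> ?bound"
    then have "f \<in> zygmund_space v" using bdd by (simp add: zygmund_space_def)
    with False show False ..
  qed
  moreover have "zygmund_norm v f = \<infinity>" using False by (simp add: zygmund_norm_def)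
  ultimately show ?thesis by (simp add: top_unique)
qed

lemma zygmund_space_iff: "f \<in> zygmund_space v \<longleftrightarrow> (\<exists>M\<ge>0. zygmund_norm v f \<le> ennreal M)"
proof
  assume "f \<in> zygmund_space v"
  then have "zygmund_norm v f < \<infinity>" by (simp add: zygmund_norm_def)
  then show "\<exists>M\<ge>0. zygmund_norm v f \<le> ennreal M"
    by (cases "zygmund_norm v f") auto
next
  assume "\<exists>M\<ge>0. zygmund_norm v f \<le> ennreal M"
  then show "f \<in> zygmund_space v" by (auto simp: zygmund_norm_def top_unique split: if_splits)
qed

lemma deriv2_cmult:
  assumes "f holomorphic_on unit_disk" "z \<in> unit_disk"
  shows "deriv (deriv (\<lambda>z. c * f z)) z = c * deriv (deriv f) z"
  using higher_deriv_cmult[OF assms, where c = c and j = 2] by (simp add: numeral_2_eq_2)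

lemma zygmund_norm_cmult_le:
  assumes v: "\<And>z. z \<in> unit_disk \<Longrightarrow> 0 \<le> v z" and "0 \<le> M" and "zygmund_norm v f \<le> ennreal M"
  shows "zygmund_norm v (\<lambda>z. c * f z) \<le> ennreal (cmod c * M)"
proof -
  have f: "f holomorphic_on unit_disk" and M: "\<And>z. z \<in> unit_disk \<Longrightarrow>
      cmod (f 0) + cmod (deriv f 0) + v z * cmod (deriv (deriv f) z) \<le> M"
    using assms(3) zygmund_norm_le_iff[OF v \<open>0 \<le> M\<close>] by auto
  have d: "deriv (\<lambda>z. c * f z) 0 = c * deriv f 0"
    using higher_deriv_cmult[OF f, of 0 1 c] by simp
  have "cmod (c * f 0) + cmod (deriv (\<lambda>z. c * f z) 0)
      + v z * cmod (deriv (deriv (\<lambda>z. c * f z)) z) \<le> cmod c * M" if z: "z \<in> unit_disk" for z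
  proof -
    have "cmod (c * f 0) + cmod (deriv (\<lambda>z. c * f z) 0)
        + v z * cmod (deriv (deriv (\<lambda>z. c * f z)) z) =
        cmod c * (cmod (f 0) + cmod (deriv f 0) + v z * cmod (deriv (deriv f) z))"
      unfolding d deriv2_cmult[OF f z] by (simp add: norm_mult algebra_simps)
    also have "\<dots> \<le> cmod c * M" using M[OF z] by (intro mult_left_mono) auto
    finally show ?thesis .
  qed
  moreover have "(\<lambda>z. c * f z) holomorphic_on unit_disk" using f by (intro holomorphic_intros)
  ultimately show ?thesis using zygmund_norm_le_iff[OF v, where M = "cmod c * M"] \<open>0 \<le> M\<close> by simp
qed

lemma deriv_comp_disk:
  assumes "f holomorphic_on unit_disk" "\<phi> holomorphic_on unit_disk" "\<phi> ` unit_disk \<subseteq> unit_disk"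
    and "z \<in> unit_disk"
  shows "deriv (f \<circ> \<phi>) z = deriv f (\<phi> z) * deriv \<phi> z"
proof (rule deriv_chain)
  have "\<phi> z \<in> unit_disk" using assms(3,4) by blast
  with assms show "\<phi> field_differentiable at z" "f field_differentiable at (\<phi> z)"
    by (auto elim!: holomorphic_on_imp_differentiable_at)
qed

lemma deriv2_comp_disk:
  assumes f: "f holomorphic_on unit_disk" and \<phi>: "\<phi> holomorphic_on unit_disk"
    and self: "\<phi> ` unit_disk \<subseteq> unit_disk" and z: "z \<in> unit_disk"
  shows "deriv (deriv (f \<circ> \<phi>)) z =
    deriv (deriv f) (\<phi> z) * (deriv \<phi> z)\<^sup>2 + deriv f (\<phi> z) * deriv (deriv \<phi>) z"
proof -
  have f': "deriv f holomorphic_on unit_disk" and \<phi>': "deriv \<phi> holomorphic_on unit_disk"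
    using f \<phi> by (auto intro!: holomorphic_deriv)
  have "deriv (f \<circ> \<phi>) holomorphic_on unit_disk"
    using f \<phi> self by (intro holomorphic_deriv holomorphic_on_compose_gen) auto
  moreover have prod: "(\<lambda>w. (deriv f \<circ> \<phi>) w * deriv \<phi> w) holomorphic_on unit_disk"
    using f' \<phi> \<phi>' self by (intro holomorphic_on_mult holomorphic_on_compose_gen) auto
  ultimately have "deriv (deriv (f \<circ> \<phi>)) z = deriv (\<lambda>w. (deriv f \<circ> \<phi>) w * deriv \<phi> w) z"
    using z deriv_comp_disk[OF f \<phi> self]
    by (intro complex_derivative_transform_within_open[where s = unit_disk]) auto
  also have "\<dots> = deriv (deriv f \<circ> \<phi>) z * deriv \<phi> z + (deriv f \<circ> \<phi>) z * deriv (deriv \<phi>) z"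
  proof (subst deriv_mult)
    show "(deriv f \<circ> \<phi>) field_differentiable at z" "deriv \<phi> field_differentiable at z"
      using z f' \<phi> \<phi>' self 
      by (auto intro!: holomorphic_on_imp_differentiable_at[where s = unit_disk]
            holomorphic_on_compose_gen[where t = unit_disk])
  qed simp
  finally show ?thesis
    by (simp add: deriv_comp_disk[OF f' \<phi> self z] power2_eq_square algebra_simps)
qed

section \<open>Primitives and the integral operators\<close>

text \<open>
  The disk is starlike about the origin, so Cauchy's theorem on triangles with a vertex at 0 makes the
  integral along radii a primitive.
\<close>

lemma disk_primitive:
  assumes "h holomorphic_on unit_disk" "z \<in> unit_disk"
  shows "((\<lambda>z. contour_integral (linepath 0 z) h) has_field_derivative h z) (at z)"
proof (rule triangle_contour_integrals_starlike_primitive)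
  show "continuous_on unit_disk h" using assms(1) by (rule holomorphic_on_imp_continuous_on)
  show "closed_segment 0 y \<subseteq> unit_disk" if "y \<in> unit_disk" for y :: complex
    using that by (intro closed_segment_subset) auto
  show "contour_integral (linepath 0 b) h + contour_integral (linepath b c) h
      + contour_integral (linepath c 0) h = 0" if bc: "closed_segment b c \<subseteq> unit_disk" for b c
  proof -
    have hull: "convex hull {0, b, c} \<subseteq> unit_disk"
      using bc by (intro hull_minimal) auto
    have "(h has_contour_integral 0) (linepath 0 b +++ linepath b c +++ linepath c 0)"
      by (rule Cauchy_theorem_triangle) (rule holomorphic_on_subset[OF assms(1) hull])
    then show ?thesis by (rule has_chain_integral_chain_integral3)
  qed
qed (use assms in auto)

lemma disk_primitive_derivs:
  assumes h: "h holomorphic_on unit_disk"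
    and F: "F = (\<lambda>z. contour_integral (linepath 0 z) h)"
  shows "F holomorphic_on unit_disk" "F 0 = 0" "\<And>z. z \<in> unit_disk \<Longrightarrow> deriv F z = h z"
    "\<And>z. z \<in> unit_disk \<Longrightarrow> deriv (deriv F) z = deriv h z"
proof -
  have dF: "(F has_field_derivative h z) (at z)" if "z \<in> unit_disk" for z
    unfolding F by (rule disk_primitive[OF h that])
  then show Fh: "F holomorphic_on unit_disk" unfolding holomorphic_on_open[OF open_ball] by blast
  show "F 0 = 0" by (simp add: F)
  show F': "deriv F z = h z" if "z \<in> unit_disk" for z
    by (rule DERIV_imp_deriv[OF dF[OF that]])
  show "deriv (deriv F) z = deriv h z" if "z \<in> unit_disk" for z
    using that F' h Fh
    by (intro complex_derivative_transform_within_open[where s = unit_disk])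
       (auto intro: holomorphic_deriv)
qed

lemma deriv2_twice_integrated:
  assumes h: "h holomorphic_on unit_disk"
    and G: "G = (\<lambda>z. contour_integral (linepath 0 z) h)"
    and F: "F = (\<lambda>z. contour_integral (linepath 0 z) G)"
  shows "F holomorphic_on unit_disk" "F 0 = 0" "deriv F 0 = 0"
    "\<And>z. z \<in> unit_disk \<Longrightarrow> deriv (deriv F) z = h z"
proof -
  note dG = disk_primitive_derivs[OF h G]
  note dF = disk_primitive_derivs[OF dG(1) F]
  show "F holomorphic_on unit_disk" "F 0 = 0" by (fact dF(1), fact dF(2))
  show "deriv F 0 = 0" using dF(3)[of 0] dG(2) by simp
  show "deriv (deriv F) z = h z" if "z \<in> unit_disk" for z
    using dF(4)[OF that] dG(3)[OF that] by simp
qed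

lemma deriv2_J_op':
  assumes "f holomorphic_on unit_disk" "u holomorphic_on unit_disk"
  shows "J_op' u f holomorphic_on unit_disk" "J_op' u f 0 = 0" "deriv (J_op' u f) 0 = 0"
    "\<And>z. z \<in> unit_disk \<Longrightarrow> deriv (deriv (J_op' u f)) z = f z * deriv u z"
  using deriv2_twice_integrated[of "\<lambda>s. f s * deriv u s" "J_op u f" "J_op' u f"] assms
  by (auto simp: J_op'_def[abs_def] J_op_def[abs_def] intro!: holomorphic_intros holomorphic_deriv)

lemma deriv2_I_op':
  assumes "f holomorphic_on unit_disk" "u holomorphic_on unit_disk"
  shows "I_op' u f holomorphic_on unit_disk" "I_op' u f 0 = 0" "deriv (I_op' u f) 0 = 0"
    "\<And>z. z \<in> unit_disk \<Longrightarrow> deriv (deriv (I_op' u f)) z = deriv f z * u z"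
  using deriv2_twice_integrated[of "\<lambda>s. deriv f s * u s" "I_op u f" "I_op' u f"] assms
  by (auto simp: I_op'_def[abs_def] I_op_def[abs_def] intro!: holomorphic_intros holomorphic_deriv)

section \<open>The norm quotients as weighted suprema\<close>

lemma zygmund_norm_power:
  assumes \<mu>: "moderate_weight \<mu>"
  shows "zygmund_norm \<mu> (\<lambda>z. z ^ (m + 2)) = ennreal (real ((m + 2) * (m + 1)) * power_sup \<mu> m)"
proof -
  have d1: "deriv (\<lambda>z::complex. z ^ (m + 2)) = (\<lambda>z. of_nat (m + 2) * z ^ (m + 1))"
    using DERIV_power[OF DERIV_ident, where n = "m + 2"] by (intro ext DERIV_imp_deriv) simp
  have d2: "deriv (\<lambda>z::complex. of_nat (m + 2) * z ^ (m + 1)) z = of_nat ((m + 2) * (m + 1)) * z ^ m"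
    for z
    using DERIV_cmult[OF DERIV_power[OF DERIV_ident, where n = "m + 1"], where c = "of_nat (m + 2) :: complex"]
    by (intro DERIV_imp_deriv) (simp add: algebra_simps)
  have norm: "\<mu> z * cmod (deriv (deriv (\<lambda>z::complex. z ^ (m + 2))) z)
      = real ((m + 2) * (m + 1)) * (\<mu> z * cmod z ^ m)" for z
    unfolding d1 d2 by (simp only: norm_mult norm_of_nat norm_power mult_ac)
  have bdd: "bdd_above ((\<lambda>z. \<mu> z * cmod z ^ m) ` unit_disk)"
    by (rule moderate_weight_bdd[OF \<mu>])
  have bdd': "bdd_above ((\<lambda>z. real ((m + 2) * (m + 1)) * (\<mu> z * cmod z ^ m)) ` unit_disk)"
    by (rule bdd_aboveI2, rule mult_left_mono[OF power_sup_upper[OF \<mu>]]) auto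
  have "k * power_sup \<mu> m = (SUP z\<in>unit_disk. k * (\<mu> z * cmod z ^ m))" if "0 \<le> k" for k
  proof -
    have "k * power_sup \<mu> m = Sup ((\<lambda>x. k * x) ` (\<lambda>z. \<mu> z * cmod z ^ m) ` unit_disk)"
      unfolding power_sup_def
      by (rule continuous_at_Sup_mono)
        (use bdd that in \<open>auto intro!: monoI mult_left_mono continuous_intros\<close>)
    then show ?thesis by (simp only: image_image)
  qed
  then have "(SUP z\<in>unit_disk. real ((m + 2) * (m + 1)) * (\<mu> z * cmod z ^ m))
      = real ((m + 2) * (m + 1)) * power_sup \<mu> m" by simp
  moreover have "(\<lambda>z. z ^ (m + 2)) \<in> zygmund_space \<mu>"
    unfolding zygmund_space_def mem_Collect_eq norm by (intro conjI bdd' holomorphic_intros)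
  moreover have "deriv (\<lambda>z::complex. z ^ (m + 2)) 0 = 0" unfolding d1 by simp
  ultimately show ?thesis by (simp only: zygmund_norm_def norm if_True) simp
qed

text \<open>
  Reduces a quotient of norms to an inequality between weighted functions. The factor \<open>a\<close> in front of
  the norm and the factor \<open>c\<close> that comes out of the second derivative of the numerator together cancel the
  constant \<open>(m + 2) * (m + 1)\<close> in the norm of the monomial.
\<close>

lemma norm_quotient_le_iff:
  assumes \<mu>: "moderate_weight \<mu>" and v: "\<And>z. z \<in> unit_disk \<Longrightarrow> 0 \<le> v z"
    and F: "F holomorphic_on unit_disk" "F 0 = 0" "deriv F 0 = 0"
      "\<And>z. z \<in> unit_disk \<Longrightarrow> cmod (deriv (deriv F) z) = real c * X z"
    and ac: "a * c = (m + 2) * (m + 1)" and "0 \<le> K"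
  shows "of_nat a * zygmund_norm v F / zygmund_norm \<mu> (\<lambda>z. z ^ (m + 2)) \<le> ennreal K \<longleftrightarrow>
    (\<forall>z\<in>unit_disk. v z * X z \<le> K * power_sup \<mu> m)"
proof -
  define P where "P = power_sup \<mu> m"
  have P: "0 < P" using power_sup_pos[OF \<mu>] by (simp add: P_def)
  have a: "0 < a" and c: "0 < c" using ac by (auto intro: Nat.gr0I)
  have "of_nat a * zygmund_norm v F / zygmund_norm \<mu> (\<lambda>z. z ^ (m + 2)) \<le> ennreal K \<longleftrightarrow>
      zygmund_norm v F \<le> ennreal (real c * (K * P))"
  proof (cases "zygmund_norm v F")
    case (real x)
    have "of_nat a * zygmund_norm v F / zygmund_norm \<mu> (\<lambda>z. z ^ (m + 2)) =
        ennreal (real a * x) / ennreal (real (a * c) * P)"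
      using real by (simp only: zygmund_norm_power[OF \<mu>] ac P_def ennreal_of_nat_eq_real_of_nat)
        (simp add: ennreal_mult)
    also have "\<dots> = ennreal (real a * x / (real (a * c) * P))"
      using real a c P by (intro divide_ennreal) auto
    also have "real a * x / (real (a * c) * P) = x / (real c * P)" using a by simp
    finally show ?thesis
      using real \<open>0 \<le> K\<close> P c by (simp add: ennreal_le_iff field_simps)
  next
    case top
    then have "of_nat a * zygmund_norm v F / zygmund_norm \<mu> (\<lambda>z. z ^ (m + 2)) = top"
      using a unfolding zygmund_norm_power[OF \<mu>]
      by (simp add: ennreal_mult_top ennreal_divide_eq_top_iff)
    with top show ?thesis by (simp add: top_unique)
  qed
  also have "\<dots> \<longleftrightarrow> (\<forall>z\<in>unit_disk. v z * (real c * X z) \<le> real c * (K * P))"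
    using \<open>0 \<le> K\<close> P F by (subst zygmund_norm_le_iff[OF v]) auto
  also have "\<dots> \<longleftrightarrow> (\<forall>z\<in>unit_disk. v z * X z \<le> K * P)"
    using c by (intro ball_cong refl) (simp add: mult.left_commute[of _ "real c"])
  finally show ?thesis by (simp add: P_def)
qed

lemma SUP_ennreal_finite_iff:
  fixes X :: "'a \<Rightarrow> ennreal"
  shows "(SUP n\<in>A. X n) < \<infinity> \<longleftrightarrow> (\<exists>K\<ge>0. \<forall>n\<in>A. X n \<le> ennreal K)"
proof
  assume "(SUP n\<in>A. X n) < \<infinity>"
  then obtain K where "0 \<le> K" "(SUP n\<in>A. X n) = ennreal K" by (cases "SUP n\<in>A. X n") auto
  then show "\<exists>K\<ge>0. \<forall>n\<in>A. X n \<le> ennreal K" by (metis SUP_upper)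
next
  assume "\<exists>K\<ge>0. \<forall>n\<in>A. X n \<le> ennreal K"
  then show "(SUP n\<in>A. X n) < \<infinity>"
    by (metis SUP_least ennreal_less_top infinity_ennreal_def order_le_less_trans)
qed

proposition J_quotients_bounded_iff:
  assumes \<phi>: "\<phi> holomorphic_on unit_disk" "\<phi> ` unit_disk \<subseteq> unit_disk"
    and \<mu>: "moderate_weight \<mu>" and v: "\<And>z. z \<in> unit_disk \<Longrightarrow> 0 \<le> v z"
  shows "(SUP n\<in>(UNIV :: nat set).
      of_nat ((n + 2) * (n + 1)) * zygmund_norm v (J_op' (deriv \<phi>) (\<lambda>z. \<phi> z ^ n))
        / zygmund_norm \<mu> (\<lambda>z. z ^ (n + 2))) < \<infinity> \<longleftrightarrow>
    (\<exists>K\<ge>0. \<forall>z\<in>unit_disk. v z * cmod (deriv (deriv \<phi>) z) \<le> K * \<mu> (\<phi> z))"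
proof -
  have \<phi>': "deriv \<phi> holomorphic_on unit_disk" using \<phi> by (auto intro: holomorphic_deriv)
  have pow: "(\<lambda>z. \<phi> z ^ n) holomorphic_on unit_disk" for n
    using \<phi>(1) by (intro holomorphic_intros)
  have "of_nat ((n + 2) * (n + 1)) * zygmund_norm v (J_op' (deriv \<phi>) (\<lambda>z. \<phi> z ^ n))
        / zygmund_norm \<mu> (\<lambda>z. z ^ (n + 2)) \<le> ennreal K \<longleftrightarrow>
      (\<forall>z\<in>unit_disk. v z * cmod (deriv (deriv \<phi>) z) * cmod (\<phi> z) ^ n \<le> K * power_sup \<mu> n)"
    if "0 \<le> K" for n K
    by (subst norm_quotient_le_iff[OF \<mu> v deriv2_J_op'(1-3)[OF pow \<phi>'], where c = 1
          and X = "\<lambda>z. cmod (deriv (deriv \<phi>) z) * cmod (\<phi> z) ^ n"])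
       (use that in \<open>auto simp: deriv2_J_op'(4)[OF pow \<phi>'] norm_mult norm_power mult_ac\<close>)
  then show ?thesis
    unfolding SUP_ennreal_finite_iff
    using power_bounds_iff_weight_bound[OF \<mu>, of \<phi> "\<lambda>z. v z * cmod (deriv (deriv \<phi>) z)"] \<phi>(2) v
    by (simp add: image_subset_iff cong: conj_cong)
qed

proposition I_quotients_bounded_iff:
  assumes \<phi>: "\<phi> holomorphic_on unit_disk" "\<phi> ` unit_disk \<subseteq> unit_disk"
    and \<mu>: "moderate_weight \<mu>" and v: "\<And>z. z \<in> unit_disk \<Longrightarrow> 0 \<le> v z"
  shows "(SUP n\<in>{1 :: nat..}.
      of_nat (n + 1) * zygmund_norm v (I_op' (deriv \<phi>) (\<lambda>z. \<phi> z ^ n))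
        / zygmund_norm \<mu> (\<lambda>z. z ^ (n + 1))) < \<infinity> \<longleftrightarrow>
    (\<exists>K\<ge>0. \<forall>z\<in>unit_disk. v z * (cmod (deriv \<phi> z))\<^sup>2 \<le> K * \<mu> (\<phi> z))"
proof -
  have \<phi>': "deriv \<phi> holomorphic_on unit_disk" using \<phi> by (auto intro: holomorphic_deriv)
  have pow: "(\<lambda>z. \<phi> z ^ n) holomorphic_on unit_disk" for n
    using \<phi>(1) by (intro holomorphic_intros)
  have dpow: "deriv (\<lambda>z. \<phi> z ^ Suc n) z = of_nat (n + 1) * \<phi> z ^ n * deriv \<phi> z"
    if "z \<in> unit_disk" for n z
    using DERIV_power[OF holomorphic_derivI[OF \<phi>(1) open_ball that], where n = "Suc n"]
    by (intro DERIV_imp_deriv) (simp add: mult_ac)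
  have eq: "of_nat (n + 2) * zygmund_norm v (I_op' (deriv \<phi>) (\<lambda>z. \<phi> z ^ Suc n))
        / zygmund_norm \<mu> (\<lambda>z. z ^ (n + 2)) \<le> ennreal K \<longleftrightarrow>
      (\<forall>z\<in>unit_disk. v z * (cmod (deriv \<phi> z))\<^sup>2 * cmod (\<phi> z) ^ n \<le> K * power_sup \<mu> n)"
    if "0 \<le> K" for n K
  proof (subst norm_quotient_le_iff[OF \<mu> v deriv2_I_op'(1-3)[OF pow \<phi>'], where c = "n + 1"
          and X = "\<lambda>z. (cmod (deriv \<phi> z))\<^sup>2 * cmod (\<phi> z) ^ n"])
    fix z assume z: "z \<in> unit_disk"
    show "cmod (deriv (deriv (I_op' (deriv \<phi>) (\<lambda>z. \<phi> z ^ Suc n))) z)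
        = real (n + 1) * ((cmod (deriv \<phi> z))\<^sup>2 * cmod (\<phi> z) ^ n)"
      unfolding deriv2_I_op'(4)[OF pow \<phi>' z] dpow[OF z]
      by (simp only: norm_mult norm_power norm_of_nat power2_eq_square mult_ac)
  qed (use that in \<open>auto simp: mult_ac\<close>)
  \<comment> \<open>Differentiating lowers the exponent, so index \<open>n\<close> tests with the power \<open>n - 1\<close>.\<close>
  have "{1 :: nat..} = range Suc" by (auto simp: image_iff Suc_le_eq gr0_conv_Suc)
  then have reindex: "(SUP n\<in>{1 :: nat..}. of_nat (n + 1) * zygmund_norm v (I_op' (deriv \<phi>) (\<lambda>z. \<phi> z ^ n))
        / zygmund_norm \<mu> (\<lambda>z. z ^ (n + 1))) =
      (SUP n. of_nat (n + 2) * zygmund_norm v (I_op' (deriv \<phi>) (\<lambda>z. \<phi> z ^ Suc n))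
        / zygmund_norm \<mu> (\<lambda>z. z ^ (n + 2)))"
    by (simp only: image_image) simp
  have "(\<exists>K\<ge>0. \<forall>n. of_nat (n + 2) * zygmund_norm v (I_op' (deriv \<phi>) (\<lambda>z. \<phi> z ^ Suc n))
        / zygmund_norm \<mu> (\<lambda>z. z ^ (n + 2)) \<le> ennreal K) \<longleftrightarrow>
      (\<exists>K\<ge>0. \<forall>n. \<forall>z\<in>unit_disk.
        v z * (cmod (deriv \<phi> z))\<^sup>2 * cmod (\<phi> z) ^ n \<le> K * power_sup \<mu> n)"
    using eq by (simp only: cong: conj_cong)
  also have "\<dots> \<longleftrightarrow> (\<exists>K\<ge>0. \<forall>z\<in>unit_disk. v z * (cmod (deriv \<phi> z))\<^sup>2 \<le> K * \<mu> (\<phi> z))"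
    using \<phi>(2) v by (intro power_bounds_iff_weight_bound[OF \<mu>]) (auto simp: image_subset_iff)
  finally show ?thesis unfolding reindex SUP_ennreal_finite_iff by simp
qed

section \<open>Growth of the derivative\<close>

text \<open>
  Integrating \<open>M / v_log\<close> along a radius gives \<open>M * ln (ln (2 / (1 - r)))\<close> up to a constant, which is how the
  second weight arises: up to constants, \<open>1 / w_log\<close> is the largest growth of the derivative of a function
  in the space.
\<close>

lemma deriv_growth:
  obtains C where "0 < C"
    "\<And>f M z. 0 \<le> M \<Longrightarrow> zygmund_norm v_log f \<le> ennreal M \<Longrightarrow> z \<in> unit_disk \<Longrightarrow>
       w_log z * cmod (deriv f z) \<le> C * M"
proof -
  define c where "c = ln (ln (4::real))"
  have c: "0 < c" using ln_ln_4_pos by (simp add: c_def)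
  define k where "k = 1 - ln (ln (2::real))"
  have "ln (ln (2::real)) < 0" using ln_2_less_1 by (simp add: ln_less_zero)
  then have k: "0 < k" unfolding k_def by linarith
  have "w_log z * cmod (deriv f z) \<le> (1 + k / c) * M"
    if "0 \<le> M" and norm: "zygmund_norm v_log f \<le> ennreal M" and z: "z \<in> unit_disk" for f M z
  proof -
    define r where "r = cmod z"
    have r: "0 \<le> r" "r < 1" using z by (auto simp: r_def)
    have f: "f holomorphic_on unit_disk" and bd: "\<And>z. z \<in> unit_disk \<Longrightarrow>
        cmod (f 0) + cmod (deriv f 0) + v_log z * cmod (deriv (deriv f) z) \<le> M"
      using norm zygmund_norm_le_iff[OF v_log_nonneg \<open>0 \<le> M\<close>] by auto
    have f': "deriv f holomorphic_on unit_disk" using f by (auto intro: holomorphic_deriv)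
    have f0: "cmod (deriv f 0) \<le> M"
    proof -
      have "0 \<le> v_log 0 * cmod (deriv (deriv f) 0)"
        by (intro mult_nonneg_nonneg v_log_nonneg) auto
      moreover have "cmod (f 0) + cmod (deriv f 0) + v_log 0 * cmod (deriv (deriv f) 0) \<le> M"
        by (rule bd) simp
      ultimately show ?thesis using norm_ge_zero[of "f 0"] by linarith
    qed
    have f2: "cmod (deriv (deriv f) w) \<le> M / v_log w" if w: "w \<in> unit_disk" for w
    proof -
      have "v_log w * cmod (deriv (deriv f) w) \<le> M"
        using bd[OF w] norm_ge_zero[of "f 0"] norm_ge_zero[of "deriv f 0"] by linarith
      then show ?thesis using v_log_pos[OF w] by (simp add: field_simps)
    qed
    \<comment> \<open>An antiderivative of the bound for the second derivative along the radius through \<open>z\<close>.\<close>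
    define G where "G t = M * ln (ln (2 / (1 - t * r)))" for t
    have tr: "t * r < 1" if "t \<le> 1" "0 \<le> t" for t
    proof -
      have "t * r \<le> 1 * r" using that r by (intro mult_right_mono) auto
      then show ?thesis using r by simp
    qed
    have in_disk: "of_real t * z \<in> unit_disk" if "0 \<le> t" "t \<le> 1" for t
      using tr[of t] that by (simp add: norm_mult r_def)
    have lnpos: "0 < ln (2 / (1 - t * r))" if "0 \<le> t" "t \<le> 1" for t
    proof -
      have "0 \<le> t * r" using that r by simp
      then show ?thesis using tr[of t] that by (intro ln_gt_zero) (simp add: field_simps)
    qed
    have hd: "((\<lambda>t. deriv f (of_real t * z)) has_vector_derivative z * deriv (deriv f) (of_real t * z))
        (at t)" if t: "0 \<le> t" "t \<le> 1" for t :: real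
    proof -
      have "((\<lambda>w. deriv f (w * z)) has_field_derivative deriv (deriv f) (of_real t * z) * z)
          (at (of_real t))"
        using holomorphic_derivI[OF f' open_ball in_disk[OF t]]
        by (rule DERIV_chain2) (auto intro!: derivative_eq_intros)
      from has_vector_derivative_real_field[OF this] show ?thesis by (simp add: mult.commute)
    qed
    have Gd: "(G has_vector_derivative r * (M / v_log (of_real t * z))) (at t)"
      if t: "0 \<le> t" "t \<le> 1" for t :: real
    proof -
      have "cmod (of_real t * z) = t * r" using t by (simp add: norm_mult r_def)
      then have v: "v_log (of_real t * z) = (1 - t * r) * ln (2 / (1 - t * r))"
        by (simp add: v_log_def)
      have y: "0 < 1 - t * r" using tr[of t] t by simp
      have "((\<lambda>t. 2 / (1 - t * r)) has_real_derivative 2 * r / (1 - t * r)\<^sup>2) (at t)"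
        using y by (auto intro!: derivative_eq_intros simp: power2_eq_square)
      from DERIV_chain2[OF DERIV_ln_divide this]
      have "((\<lambda>t. ln (2 / (1 - t * r))) has_real_derivative r / (1 - t * r)) (at t)"
        using y by (simp add: power2_eq_square)
      from DERIV_cmult[OF DERIV_chain2[OF DERIV_ln_divide[OF lnpos[OF t]] this], of M]
      have "(G has_real_derivative r * (M / v_log (of_real t * z))) (at t)"
        unfolding v G_def[abs_def] by (simp add: mult_ac)
      then show ?thesis by (simp add: has_real_derivative_iff_has_vector_derivative)
    qed
    have "cmod (deriv f (of_real 1 * z) - deriv f (of_real 0 * z)) \<le> G 1 - G 0"
    proof (rule differentiable_bound_general)
      show "continuous_on {0..1} (\<lambda>t. deriv f (of_real t * z))"
        using hd by (intro continuous_at_imp_continuous_on ballI)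
          (auto intro: has_vector_derivative_continuous)
      show "continuous_on {0..1} G"
        using Gd by (intro continuous_at_imp_continuous_on ballI)
          (auto intro: has_vector_derivative_continuous)
      fix t :: real assume t: "0 < t" "t < 1"
      show "cmod (z * deriv (deriv f) (of_real t * z)) \<le> r * (M / v_log (of_real t * z))"
        unfolding norm_mult r_def using f2 in_disk t by (intro mult_left_mono) auto
    qed (use hd Gd in auto)
    then have "cmod (deriv f z) \<le> M + (G 1 - G 0)"
      using f0 norm_triangle_sub[of "deriv f z" "deriv f 0"] by simp
    also have "\<dots> = M * (k + ln (ln (2 / (1 - r))))"
      by (simp add: G_def k_def algebra_simps)
    also have "\<dots> \<le> M * (k + ln (ln (4 / (1 - r\<^sup>2))))"
    proof -
      have "r\<^sup>2 < 1" using r by (simp add: abs_square_less_1)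
      have "0 \<le> (1 - r)\<^sup>2" by simp
      then have "2 / (1 - r) \<le> 4 / (1 - r\<^sup>2)"
        using r \<open>r\<^sup>2 < 1\<close> by (simp add: field_simps power2_eq_square)
      then have "ln (2 / (1 - r)) \<le> ln (4 / (1 - r\<^sup>2))"
        using r by (intro ln_mono) auto
      then have "ln (ln (2 / (1 - r))) \<le> ln (ln (4 / (1 - r\<^sup>2)))"
        by (rule ln_mono) (use lnpos[of 1] r in simp)
      then show ?thesis using \<open>0 \<le> M\<close> by (intro mult_left_mono) auto
    qed
    also have "\<dots> \<le> M * ((1 + k / c) * ln (ln (4 / (1 - r\<^sup>2))))"
    proof (intro mult_left_mono \<open>0 \<le> M\<close>)
      have "c \<le> ln (ln (4 / (1 - r\<^sup>2)))" using ln_ln_4_le_ln_ln[OF z] by (simp add: c_def r_def)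
      then have "k * c \<le> k * ln (ln (4 / (1 - r\<^sup>2)))" using k by (intro mult_left_mono) auto
      then show "k + ln (ln (4 / (1 - r\<^sup>2))) \<le> (1 + k / c) * ln (ln (4 / (1 - r\<^sup>2)))"
        using c by (simp add: field_simps)
    qed
    also have "\<dots> = M * ((1 + k / c) * inverse (w_log z))" by (simp add: w_log_def r_def)
    finally have "w_log z * cmod (deriv f z) \<le> w_log z * (M * ((1 + k / c) * inverse (w_log z)))"
      using w_log_pos[OF z] by (intro mult_left_mono) auto
    also have "\<dots> = (1 + k / c) * M * (w_log z * inverse (w_log z))" by (simp only: mult_ac)
    also have "\<dots> = (1 + k / c) * M" using w_log_pos[OF z] by simp
    finally show ?thesis .
  qed
  moreover have "0 < 1 + k / c" using k c by (simp add: add_pos_pos)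
  ultimately show thesis using that by blast
qed

text \<open>
  Point evaluations of a function and of its derivative are bounded functionals. At \<open>\<phi> 0\<close> this controls
  the first two terms of the norm of a composition.
\<close>

lemma value_growth:
  assumes "z \<in> unit_disk"
  obtains C where "0 < C"
    "\<And>f M. 0 \<le> M \<Longrightarrow> zygmund_norm v_log f \<le> ennreal M \<Longrightarrow>
       cmod (f z) \<le> C * M \<and> cmod (deriv f z) \<le> C * M"
proof -
  obtain C where "0 < C" and C: "\<And>f M z. 0 \<le> M \<Longrightarrow> zygmund_norm v_log f \<le> ennreal M \<Longrightarrow>
      z \<in> unit_disk \<Longrightarrow> w_log z * cmod (deriv f z) \<le> C * M"
    using deriv_growth by metis
  define B where "B = C / w_log z"
  have B: "0 < B" using \<open>0 < C\<close> w_log_pos[OF assms] by (simp add: B_def)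
  have "cmod (f z) \<le> (1 + B) * M \<and> cmod (deriv f z) \<le> (1 + B) * M"
    if "0 \<le> M" and norm: "zygmund_norm v_log f \<le> ennreal M" for f M
  proof -
    have f: "f holomorphic_on unit_disk" and bd: 
        "cmod (f 0) + cmod (deriv f 0) + v_log 0 * cmod (deriv (deriv f) 0) \<le> M"
      using norm zygmund_norm_le_iff[OF v_log_nonneg \<open>0 \<le> M\<close>] by auto
    have f0: "cmod (f 0) \<le> M"
    proof -
      have "0 \<le> v_log 0 * cmod (deriv (deriv f) 0)"
        by (intro mult_nonneg_nonneg v_log_nonneg) auto
      with bd norm_ge_zero[of "deriv f 0"] show ?thesis by linarith
    qed
    have d: "cmod (deriv f w) \<le> B * M" if w: "w \<in> cball 0 (cmod z)" for w
    proof -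
      have wd: "w \<in> unit_disk" using w assms by auto
      have "w_log z \<le> w_log w"
      proof -
        have "(cmod w)\<^sup>2 \<le> (cmod z)\<^sup>2" using w by (intro power_mono) auto
        moreover have "(cmod z)\<^sup>2 < 1" using assms by (simp add: abs_square_less_1)
        ultimately have "4 / (1 - (cmod w)\<^sup>2) \<le> 4 / (1 - (cmod z)\<^sup>2)"
          by (intro divide_left_mono mult_pos_pos) linarith+
        moreover have "0 < 4 / (1 - (cmod w)\<^sup>2)" using wd by (simp add: abs_square_less_1)
        ultimately have "ln (4 / (1 - (cmod w)\<^sup>2)) \<le> ln (4 / (1 - (cmod z)\<^sup>2))"
          by (intro ln_mono) auto
        moreover have "0 < ln (4 / (1 - (cmod w)\<^sup>2))"
          using ln_4_le_ln[OF wd] ln_4_gt_1 by linarith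
        ultimately have "ln (ln (4 / (1 - (cmod w)\<^sup>2))) \<le> ln (ln (4 / (1 - (cmod z)\<^sup>2)))"
          by (rule ln_mono)
        then show ?thesis 
          using order_less_le_trans[OF ln_ln_4_pos ln_ln_4_le_ln_ln[OF wd]]
          unfolding w_log_def by (intro le_imp_inverse_le)
      qed
      then have "w_log z * cmod (deriv f w) \<le> w_log w * cmod (deriv f w)"
        by (intro mult_right_mono) auto
      also have "\<dots> \<le> C * M" by (rule C[OF \<open>0 \<le> M\<close> norm wd])
      finally show ?thesis using w_log_pos[OF assms] by (simp add: B_def field_simps)
    qed
    have "cmod (f z - f 0) \<le> B * M * cmod (z - 0)"
    proof (rule field_differentiable_bound)
      fix w :: complex assume w: "w \<in> cball 0 (cmod z)"
      then have "w \<in> unit_disk" using assms by auto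
      then show "(f has_field_derivative deriv f w) (at w within cball 0 (cmod z))"
        by (rule holomorphic_derivI[OF f open_ball])
    qed (use d in auto)
    also have "\<dots> \<le> B * M * 1" using assms B \<open>0 \<le> M\<close> by (intro mult_left_mono) auto
    finally have "cmod (f z) \<le> M + B * M" using f0 norm_triangle_sub[of "f z" "f 0"] by linarith
    moreover have "cmod (deriv f z) \<le> B * M" by (rule d) simp
    ultimately show ?thesis using \<open>0 \<le> M\<close> by (auto simp: algebra_simps)
  qed
  then show thesis using that[of "1 + B"] B by simp
qed

section \<open>Sufficiency\<close>

lemma comp_op_bounded:
  assumes \<phi>: "\<phi> holomorphic_on unit_disk" "\<phi> ` unit_disk \<subseteq> unit_disk"
    and K1: "0 \<le> K1" "\<And>z. z \<in> unit_disk \<Longrightarrow> v_log z * cmod (deriv (deriv \<phi>) z) \<le> K1 * w_log (\<phi> z)"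
    and K2: "0 \<le> K2" "\<And>z. z \<in> unit_disk \<Longrightarrow> v_log z * (cmod (deriv \<phi> z))\<^sup>2 \<le> K2 * v_log (\<phi> z)"
  obtains B where "0 < B"
    "\<And>f M. 0 \<le> M \<Longrightarrow> zygmund_norm v_log f \<le> ennreal M \<Longrightarrow>
       zygmund_norm v_log (comp_op \<phi> f) \<le> ennreal (B * M)"
proof -
  have "(0 :: complex) \<in> unit_disk" by simp
  then have "\<phi> 0 \<in> unit_disk" using \<phi>(2) by blast
  then obtain C0 where "0 < C0" and C0: "\<And>f M. 0 \<le> M \<Longrightarrow> zygmund_norm v_log f \<le> ennreal M \<Longrightarrow>
       cmod (f (\<phi> 0)) \<le> C0 * M \<and> cmod (deriv f (\<phi> 0)) \<le> C0 * M"
    using value_growth by metis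
  obtain C where "0 < C" and C: "\<And>f M z. 0 \<le> M \<Longrightarrow> zygmund_norm v_log f \<le> ennreal M \<Longrightarrow>
      z \<in> unit_disk \<Longrightarrow> w_log z * cmod (deriv f z) \<le> C * M"
    using deriv_growth by metis
  define B where "B = C0 + C0 * cmod (deriv \<phi> 0) + (K2 + K1 * C)"
  have "0 < B" using \<open>0 < C0\<close> \<open>0 < C\<close> K1(1) K2(1) by (simp add: B_def add_pos_nonneg)
  moreover have "zygmund_norm v_log (comp_op \<phi> f) \<le> ennreal (B * M)"
    if "0 \<le> M" and norm: "zygmund_norm v_log f \<le> ennreal M" for f M
  proof -
    have f: "f holomorphic_on unit_disk" and bd: "\<And>z. z \<in> unit_disk \<Longrightarrow>
        cmod (f 0) + cmod (deriv f 0) + v_log z * cmod (deriv (deriv f) z) \<le> M"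
      using norm zygmund_norm_le_iff[OF v_log_nonneg \<open>0 \<le> M\<close>] by auto
    have "cmod ((f \<circ> \<phi>) 0) + cmod (deriv (f \<circ> \<phi>) 0)
        + v_log z * cmod (deriv (deriv (f \<circ> \<phi>)) z) \<le> B * M" if z: "z \<in> unit_disk" for z
    proof -
      have b: "\<phi> z \<in> unit_disk" using \<phi>(2) z by blast
      have v: "0 < v_log z" "0 < v_log (\<phi> z)" using v_log_pos z b by auto
      have f2: "v_log (\<phi> z) * cmod (deriv (deriv f) (\<phi> z)) \<le> M"
        using bd[OF b] norm_ge_zero[of "f 0"] norm_ge_zero[of "deriv f 0"] by linarith
      have d0: "deriv (f \<circ> \<phi>) 0 = deriv f (\<phi> 0) * deriv \<phi> 0"
        by (rule deriv_comp_disk[OF f \<phi>]) simp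
      have "v_log z * cmod (deriv (deriv (f \<circ> \<phi>)) z) \<le>
          v_log z * (cmod (deriv (deriv f) (\<phi> z) * (deriv \<phi> z)\<^sup>2)
            + cmod (deriv f (\<phi> z) * deriv (deriv \<phi>) z))"
        unfolding deriv2_comp_disk[OF f \<phi> z] using v
        by (intro mult_left_mono norm_triangle_ineq) auto
      also have "\<dots> = (v_log z * (cmod (deriv \<phi> z))\<^sup>2) * cmod (deriv (deriv f) (\<phi> z))
          + (v_log z * cmod (deriv (deriv \<phi>) z)) * cmod (deriv f (\<phi> z))"
        by (simp add: norm_mult norm_power algebra_simps)
      also have "\<dots> \<le> (K2 * v_log (\<phi> z)) * cmod (deriv (deriv f) (\<phi> z))
          + (K1 * w_log (\<phi> z)) * cmod (deriv f (\<phi> z))"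
        using K1(2)[OF z] K2(2)[OF z] by (intro add_mono mult_right_mono) auto
      also have "\<dots> \<le> K2 * M + K1 * (C * M)"
        unfolding mult.assoc using f2 C[OF \<open>0 \<le> M\<close> norm b] K1(1) K2(1)
        by (intro add_mono mult_left_mono) auto
      finally have 1: "v_log z * cmod (deriv (deriv (f \<circ> \<phi>)) z) \<le> K2 * M + K1 * (C * M)" .
      have 2: "cmod ((f \<circ> \<phi>) 0) \<le> C0 * M" using C0[OF \<open>0 \<le> M\<close> norm] by simp
      have 3: "cmod (deriv (f \<circ> \<phi>) 0) \<le> C0 * M * cmod (deriv \<phi> 0)"
        unfolding d0 norm_mult using C0[OF \<open>0 \<le> M\<close> norm] by (intro mult_right_mono) auto
      show ?thesis using 1 2 3 by (simp add: B_def algebra_simps)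
    qed
    moreover have "(f \<circ> \<phi>) holomorphic_on unit_disk"
      using f \<phi> by (intro holomorphic_on_compose_gen) auto
    moreover have "0 \<le> B * M" using \<open>0 < B\<close> \<open>0 \<le> M\<close> by simp
    ultimately show ?thesis
      using zygmund_norm_le_iff[OF v_log_nonneg, where M = "B * M"] by (simp add: comp_op_def)
  qed
  ultimately show thesis using that by blast
qed

lemma continuous_comp_op_if_bounded:
  assumes "0 < B" and B: "\<And>f M. 0 \<le> M \<Longrightarrow> zygmund_norm v_log f \<le> ennreal M \<Longrightarrow>
       zygmund_norm v_log (comp_op \<phi> f) \<le> ennreal (B * M)"
  shows "continuous_on_zygmund v_log (comp_op \<phi>)"
  unfolding continuous_on_zygmund_def
proof (intro conjI ballI allI impI)
  fix f assume "f \<in> zygmund_space v_log"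
  then obtain M where "0 \<le> M" "zygmund_norm v_log f \<le> ennreal M"
    unfolding zygmund_space_iff by blast
  with B \<open>0 < B\<close> show "comp_op \<phi> f \<in> zygmund_space v_log"
    unfolding zygmund_space_iff by (meson less_imp_le mult_nonneg_nonneg)
next
  fix f and e :: real assume "0 < e"
  define d where "d = e / (2 * B)"
  have "zygmund_norm v_log (\<lambda>z. comp_op \<phi> g z - comp_op \<phi> f z) < ennreal e"
    if "zygmund_norm v_log (\<lambda>z. g z - f z) < ennreal d" for g
  proof -
    have "zygmund_norm v_log (comp_op \<phi> (\<lambda>z. g z - f z)) \<le> ennreal (B * d)"
      using that \<open>0 < e\<close> \<open>0 < B\<close> by (intro B) (auto simp: d_def)
    also have "\<dots> < ennreal e" using \<open>0 < e\<close> \<open>0 < B\<close> by (simp add: d_def ennreal_less_iff)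
    finally show ?thesis by (simp add: comp_op_def o_def)
  qed
  moreover have "0 < d" using \<open>0 < e\<close> \<open>0 < B\<close> by (simp add: d_def)
  ultimately show "\<exists>d>0. \<forall>g\<in>zygmund_space v_log.
      zygmund_norm v_log (\<lambda>z. g z - f z) < ennreal d \<longrightarrow>
      zygmund_norm v_log (\<lambda>z. comp_op \<phi> g z - comp_op \<phi> f z) < ennreal e" by blast
qed

section \<open>Necessity\<close>

text \<open>
  Continuity at 0, rescaled: the ball of radius \<open>M\<close> is shrunk into the ball of radius \<open>d\<close> that is mapped
  into the unit ball.
\<close>

lemma deriv2_comp_bounded_if_continuous:
  assumes \<phi>: "\<phi> holomorphic_on unit_disk" "\<phi> ` unit_disk \<subseteq> unit_disk"
    and cont: "continuous_on_zygmund v_log (comp_op \<phi>)" and "0 < M"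
  obtains K where "0 < K"
    "\<And>f z. zygmund_norm v_log f \<le> ennreal M \<Longrightarrow> z \<in> unit_disk \<Longrightarrow>
       v_log z * cmod (deriv (deriv (f \<circ> \<phi>)) z) \<le> K"
proof -
  have zero: "(\<lambda>z. 0) \<in> zygmund_space v_log" by (auto simp: zygmund_space_def)
  from bspec[OF conjunct2[OF cont[unfolded continuous_on_zygmund_def]] zero, rule_format,
      OF zero_less_one]
  obtain d where "0 < d" and d: "\<And>g. g \<in> zygmund_space v_log \<Longrightarrow>
      zygmund_norm v_log g < ennreal d \<Longrightarrow> zygmund_norm v_log (comp_op \<phi> g) < ennreal 1"
    by (auto simp: comp_op_def o_def)
  define a where "a = d / (2 * M)"
  have "0 < a" using \<open>0 < d\<close> \<open>0 < M\<close> by (simp add: a_def)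
  have "v_log z * cmod (deriv (deriv (f \<circ> \<phi>)) z) \<le> 1 / a"
    if norm: "zygmund_norm v_log f \<le> ennreal M" and z: "z \<in> unit_disk" for f z
  proof -
    have f: "f holomorphic_on unit_disk"
      using norm zygmund_norm_le_iff[OF v_log_nonneg less_imp_le[OF \<open>0 < M\<close>]] by auto
    let ?g = "\<lambda>z. complex_of_real a * f z"
    have "zygmund_norm v_log ?g \<le> ennreal (a * M)"
      using zygmund_norm_cmult_le[OF v_log_nonneg less_imp_le[OF \<open>0 < M\<close>] norm, of "of_real a"] \<open>0 < a\<close>
      by simp
    moreover have "ennreal (a * M) < ennreal d"
      using \<open>0 < M\<close> \<open>0 < d\<close> by (simp add: a_def ennreal_less_iff)
    moreover have "?g \<in> zygmund_space v_log"
      unfolding zygmund_space_iff using calculation(1) \<open>0 < a\<close> \<open>0 < M\<close>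
      by (metis less_imp_le mult_nonneg_nonneg)
    ultimately have "zygmund_norm v_log (comp_op \<phi> ?g) \<le> ennreal 1"
      using d by (meson less_imp_le order_le_less_trans)
    then have "cmod (comp_op \<phi> ?g 0) + cmod (deriv (comp_op \<phi> ?g) 0)
        + v_log z * cmod (deriv (deriv (comp_op \<phi> ?g)) z) \<le> 1"
      using z by (subst (asm) zygmund_norm_le_iff[OF v_log_nonneg]) auto
    then have "v_log z * cmod (deriv (deriv (comp_op \<phi> ?g)) z) \<le> 1"
      using norm_ge_zero[of "comp_op \<phi> ?g 0"] norm_ge_zero[of "deriv (comp_op \<phi> ?g) 0"] by linarith
    moreover have "comp_op \<phi> ?g = (\<lambda>z. of_real a * (f \<circ> \<phi>) z)" by (simp add: comp_op_def o_def)
    moreover have "deriv (deriv (\<lambda>z. of_real a * (f \<circ> \<phi>) z)) z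
        = of_real a * deriv (deriv (f \<circ> \<phi>)) z"
      using f \<phi> z by (intro deriv2_cmult holomorphic_on_compose_gen) auto
    ultimately show ?thesis using \<open>0 < a\<close> by (simp add: norm_mult field_simps)
  qed
  then show thesis using that[of "1 / a"] \<open>0 < a\<close> by simp
qed

lemma cmod_one_minus_cnj_mult_bounds:
  assumes "b \<in> unit_disk" "z \<in> unit_disk"
  shows "1 - cmod z \<le> cmod (1 - cnj b * z)" "1 - (cmod b)\<^sup>2 \<le> 2 * cmod (1 - cnj b * z)"
    "0 < cmod (1 - cnj b * z)" "cmod (1 - cnj b * z) < 2" "0 < Re (1 - cnj b * z)"
proof -
  have b: "0 \<le> cmod b" "cmod b < 1" and z: "0 \<le> cmod z" "cmod z < 1" using assms by auto
  have bz: "cmod (cnj b * z) = cmod b * cmod z" by (simp add: norm_mult)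
  have le: "cmod b * cmod z \<le> 1 * cmod z" "cmod b * cmod z \<le> cmod b * 1"
    using b z by (intro mult_right_mono mult_left_mono; simp)+
  have lower: "1 - cmod b * cmod z \<le> cmod (1 - cnj b * z)"
    using norm_triangle_ineq2[of 1 "cnj b * z"] bz by simp
  then show "1 - cmod z \<le> cmod (1 - cnj b * z)" using le by linarith
  have "1 - (cmod b)\<^sup>2 = (1 + cmod b) * (1 - cmod b)" by (simp add: power2_eq_square algebra_simps)
  also have "\<dots> \<le> 2 * (1 - cmod b)" using b by (intro mult_right_mono) auto
  finally show "1 - (cmod b)\<^sup>2 \<le> 2 * cmod (1 - cnj b * z)" using lower le by argo
  show "0 < cmod (1 - cnj b * z)" using lower le z by linarith
  show "cmod (1 - cnj b * z) < 2" using norm_triangle_ineq4[of 1 "cnj b * z"] bz le z by simp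
  have "Re (cnj b * z) < 1" using complex_Re_le_cmod[of "cnj b * z"] bz le z by linarith
  then show "0 < Re (1 - cnj b * z)" by simp
qed

text \<open>
  The function attaining the largest growth of the derivative at \<open>b\<close>: its derivative is
  \<open>Ln (Ln (4 / (1 - cnj b * z)))\<close>, equal to \<open>1 / w_log b\<close> at \<open>z = b\<close>. The second derivative is
  \<open>cnj b / ((1 - cnj b * z) * Ln (4 / (1 - cnj b * z)))\<close>. It is bounded by \<open>1 / v_log\<close> up to a constant because
  \<open>cmod (1 - cnj b * z) \<ge> 1 - cmod z\<close> and \<open>t * ln (4 / t)\<close> is almost increasing on the interval from 0 to 2.
\<close>

lemma test_function_loglog:
  obtains M where "0 < M"
    "\<And>b. b \<in> unit_disk \<Longrightarrow> \<exists>f. zygmund_norm v_log f \<le> ennreal M \<and>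
       cmod (deriv f b) = inverse (w_log b)"
proof -
  define M where "M = ln (ln 4) + (1 + 1 / ln (2::real))"
  have ln2: "0 < ln (2::real)" by simp
  have "\<exists>f. zygmund_norm v_log f \<le> ennreal M \<and> cmod (deriv f b) = inverse (w_log b)"
    if b: "b \<in> unit_disk" for b
  proof -
    define \<zeta> where "\<zeta> z = 4 / (1 - cnj b * z)" for z
    define h where "h z = Ln (Ln (\<zeta> z))" for z
    note bounds = cmod_one_minus_cnj_mult_bounds[OF b]
    have nz: "1 - cnj b * z \<noteq> 0" if "z \<in> unit_disk" for z using bounds(3)[OF that] by auto
    have Re: "0 < Re (\<zeta> z)" if "z \<in> unit_disk" for z
    proof -
      have "0 < Re (4 / w)" if "0 < Re w" for w
        using that by (auto simp: Re_divide intro!: divide_pos_pos add_pos_nonneg)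
      then show ?thesis unfolding \<zeta>_def using bounds(5)[OF that] by blast
    qed
    have norm: "cmod (\<zeta> z) = 4 / cmod (1 - cnj b * z)" for z by (simp add: \<zeta>_def norm_divide)
    have ln: "ln 2 \<le> ln (4 / cmod (1 - cnj b * z))" if "z \<in> unit_disk" for z
      using bounds(3,4)[OF that] by (subst ln_le_cancel_iff) (auto simp: field_simps)
    have ReLn: "Re (Ln (\<zeta> z)) = ln (4 / cmod (1 - cnj b * z))" if "z \<in> unit_disk" for z
      using Re[OF that] norm[of z] by (subst Re_Ln) auto
    have ReLn_pos: "0 < Re (Ln (\<zeta> z))" if "z \<in> unit_disk" for z
      using ln[OF that] ReLn[OF that] ln2 by linarith
    have dh: "(h has_field_derivative cnj b / ((1 - cnj b * z) * Ln (\<zeta> z))) (at z)"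
      if z: "z \<in> unit_disk" for z
    proof -
      have 1: "\<zeta> z \<notin> \<real>\<^sub>\<le>\<^sub>0" "Ln (\<zeta> z) \<notin> \<real>\<^sub>\<le>\<^sub>0"
        using Re[OF z] ReLn_pos[OF z] by (auto simp: complex_nonpos_Reals_iff)
      have "(\<zeta> has_field_derivative 4 * cnj b / (1 - cnj b * z)\<^sup>2) (at z)"
        unfolding \<zeta>_def[abs_def] using nz[OF z]
        by (auto intro!: derivative_eq_intros simp: power2_eq_square)
      then have "((\<lambda>w. Ln (\<zeta> w)) has_field_derivative
          inverse (\<zeta> z) * (4 * cnj b / (1 - cnj b * z)\<^sup>2)) (at z)"
        by (rule DERIV_chain2[where f = Ln and g = \<zeta>, OF has_field_derivative_Ln[OF 1(1)]])
      then have "(h has_field_derivative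
          inverse (Ln (\<zeta> z)) * (inverse (\<zeta> z) * (4 * cnj b / (1 - cnj b * z)\<^sup>2))) (at z)"
        unfolding h_def[abs_def]
        by (rule DERIV_chain2[where f = Ln and g = "\<lambda>w. Ln (\<zeta> w)",
              OF has_field_derivative_Ln[OF 1(2)]])
      also have "inverse (\<zeta> z) * (4 * cnj b / (1 - cnj b * z)\<^sup>2) = cnj b / (1 - cnj b * z)"
        using nz[OF z] by (simp add: \<zeta>_def power2_eq_square)
      finally show ?thesis by (simp add: field_simps)
    qed
    then have hol: "h holomorphic_on unit_disk" unfolding holomorphic_on_open[OF open_ball] by blast
    define f where "f = (\<lambda>z. contour_integral (linepath 0 z) h)"
    note fh = disk_primitive_derivs(1)[OF hol f_def]
      and f0 = disk_primitive_derivs(2)[OF hol f_def]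
      and f' = disk_primitive_derivs(3)[OF hol f_def]
    have f'': "deriv (deriv f) z = cnj b / ((1 - cnj b * z) * Ln (\<zeta> z))" if z: "z \<in> unit_disk" for z
      unfolding disk_primitive_derivs(4)[OF hol f_def z]
      by (rule DERIV_imp_deriv[OF dh[OF z]])
    have real_h: "h z = of_real (ln (ln (4 / x)))"
      if "1 - cnj b * z = of_real x" "0 < x" "1 < ln (4 / x)" for z x
    proof -
      have "\<zeta> z = of_real (4 / x)" using that by (simp add: \<zeta>_def)
      then have "Ln (\<zeta> z) = of_real (ln (4 / x))" 
        using that(2) by (simp only: Ln_of_real divide_pos_pos zero_less_numeral)
      then show ?thesis using that(3) by (simp add: h_def Ln_of_real)
    qed
    have h0: "h 0 = of_real (ln (ln 4))" using real_h[of 0 1] ln_4_gt_1 by simp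
    have hb: "h b = of_real (inverse (w_log b))"
    proof -
      have "1 - cnj b * b = of_real (1 - (cmod b)\<^sup>2)"
        using complex_norm_square[of b] by (simp add: mult.commute)
      moreover have "1 < ln (4 / (1 - (cmod b)\<^sup>2))" using ln_4_le_ln[OF b] ln_4_gt_1 by linarith
      ultimately show ?thesis 
        using real_h[of b "1 - (cmod b)\<^sup>2"] b by (simp add: w_log_def abs_square_less_1)
    qed
    have "v_log z * cmod (deriv (deriv f) z) \<le> 1 + 1 / ln 2" if z: "z \<in> unit_disk" for z
    proof -
      define p t where "p = 1 - cmod z" and "t = cmod (1 - cnj b * z)"
      have pt: "0 < p" "p \<le> t" "0 < t" using z bounds[OF z] by (auto simp: p_def t_def)
      have l: "ln 2 \<le> ln (4 / t)" using ln[OF z] by (simp add: t_def)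
      have "v_log z = p * ln (2 / p)" by (simp add: v_log_def p_def)
      also have "\<dots> \<le> p * ln (4 / p)" using pt by (intro mult_left_mono ln_mono divide_right_mono) auto
      also have "\<dots> \<le> p * (ln (4 / t) + t / p)"
        using ln_le_add_ratio[of 4 p t] pt by (intro mult_left_mono) auto
      also have "\<dots> = p * ln (4 / t) + t * 1" using pt by (simp add: field_simps)
      also have "\<dots> \<le> t * ln (4 / t) + t * (ln (4 / t) / ln 2)"
        using pt l ln2 order_trans[OF less_imp_le[OF ln2] l]
        by (intro add_mono mult_left_mono mult_right_mono) auto
      also have "\<dots> = (1 + 1 / ln 2) * (t * ln (4 / t))" by (simp add: field_simps)
      finally have v: "v_log z \<le> (1 + 1 / ln 2) * (t * ln (4 / t))" .
      have tl: "0 < t * ln (4 / t)" using pt ln2 l by (intro mult_pos_pos) linarith+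
      have "cmod (deriv (deriv f) z) = cmod b / (t * cmod (Ln (\<zeta> z)))"
        unfolding f''[OF z] by (simp add: norm_divide norm_mult t_def)
      also have "\<dots> \<le> 1 / (t * ln (4 / t))"
      proof (rule frac_le)
        show "t * ln (4 / t) \<le> t * cmod (Ln (\<zeta> z))"
          using complex_Re_le_cmod[of "Ln (\<zeta> z)"] ReLn[OF z] pt
          by (intro mult_left_mono) (auto simp: t_def)
      qed (use b tl in auto)
      finally have "v_log z * cmod (deriv (deriv f) z) \<le>
          (1 + 1 / ln 2) * (t * ln (4 / t)) * (1 / (t * ln (4 / t)))"
        using v v_log_nonneg[OF z] tl ln2 by (intro mult_mono) (auto intro!: mult_nonneg_nonneg)
      also have "\<dots> = 1 + 1 / ln 2"
        using nonzero_mult_div_cancel_right[OF less_imp_neq[OF tl, symmetric], of "1 + 1 / ln 2"]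
        by (simp only: times_divide_eq_right mult_1_right)
      finally show ?thesis .
    qed
    moreover note f0
    moreover have "cmod (deriv f 0) = ln (ln 4)" using f'[of 0] h0 ln_ln_4_pos by simp
    ultimately have "zygmund_norm v_log f \<le> ennreal M"
      using fh ln_ln_4_pos ln2 by (subst zygmund_norm_le_iff[OF v_log_nonneg]) (auto simp: M_def)
    moreover have "cmod (deriv f b) = inverse (w_log b)"
      using f'[OF b] hb w_log_pos[OF b]
      by (simp only: norm_of_real abs_of_pos positive_imp_inverse_positive)
    ultimately show ?thesis by blast
  qed
  moreover have "0 < M" using ln_ln_4_pos ln2 unfolding M_def by (intro add_pos_pos) auto
  ultimately show thesis using that by blast
qed

text \<open>
  The function whose derivative is the disk automorphism \<open>(z - b) / (1 - cnj b * z)\<close> divided by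
  \<open>ln (4 / (1 - (cmod b)\<^sup>2))\<close>. It is critical at \<open>b\<close>, and its second derivative has modulus
  \<open>(1 - (cmod b)\<^sup>2) / (cmod (1 - cnj b * z))\<^sup>2\<close> divided by the same logarithm, so it is of maximal size
  \<open>1 / v_log b\<close> at \<open>b\<close>.
\<close>

lemma test_function_critical:
  obtains M where "0 < M"
    "\<And>b. b \<in> unit_disk \<Longrightarrow> \<exists>f. zygmund_norm v_log f \<le> ennreal M \<and>
       deriv f b = 0 \<and> 1 \<le> 4 * v_log b * cmod (deriv (deriv f) b)"
proof -
  have "\<exists>f. zygmund_norm v_log f \<le> ennreal 7 \<and>
      deriv f b = 0 \<and> 1 \<le> 4 * v_log b * cmod (deriv (deriv f) b)"
    if b: "b \<in> unit_disk" for b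
  proof -
    define q where "q = 1 - (cmod b)\<^sup>2"
    define L where "L = ln (4 / q)"
    have q: "0 < q" "q \<le> 1" using b by (auto simp: q_def abs_square_less_1)
    have L: "1 < L" using ln_4_le_ln[OF b] ln_4_gt_1 by (simp add: L_def q_def)
    have qc: "of_real q = 1 - cnj b * b"
      using complex_norm_square[of b] by (simp add: q_def mult.commute)
    define h where "h z = (z - b) / (1 - cnj b * z) / of_real L" for z
    note bounds = cmod_one_minus_cnj_mult_bounds[OF b]
    have nz: "1 - cnj b * z \<noteq> 0" if "z \<in> unit_disk" for z using bounds(3)[OF that] by auto
    have dh: "(h has_field_derivative of_real q / (1 - cnj b * z)\<^sup>2 / of_real L) (at z)"
      if z: "z \<in> unit_disk" for z
      unfolding h_def[abs_def] qc using nz[OF z]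
      by (intro DERIV_cdivide)
        (auto intro!: derivative_eq_intros simp: power2_eq_square field_simps)
    then have hol: "h holomorphic_on unit_disk" unfolding holomorphic_on_open[OF open_ball] by blast
    define f where "f = (\<lambda>z. contour_integral (linepath 0 z) h)"
    note fh = disk_primitive_derivs(1)[OF hol f_def]
      and f0 = disk_primitive_derivs(2)[OF hol f_def]
      and f' = disk_primitive_derivs(3)[OF hol f_def]
    have "deriv (deriv f) z = of_real q / (1 - cnj b * z)\<^sup>2 / of_real L" if z: "z \<in> unit_disk" for z
      unfolding disk_primitive_derivs(4)[OF hol f_def z]
      by (rule DERIV_imp_deriv[OF dh[OF z]])
    then have f'': "cmod (deriv (deriv f) z) = q / ((cmod (1 - cnj b * z))\<^sup>2 * L)"
      if "z \<in> unit_disk" for z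
      using that q L by (simp add: norm_divide norm_mult norm_power)
    \<comment> \<open>Replacing \<open>ln (4 / p)\<close> by \<open>L\<close> costs \<open>q / p\<close>, and both \<open>p\<close> and \<open>q\<close> are controlled by \<open>t\<close>.\<close>
    have "v_log z * cmod (deriv (deriv f) z) \<le> 6" if z: "z \<in> unit_disk" for z
    proof -
      define p t where "p = 1 - cmod z" and "t = cmod (1 - cnj b * z)"
      have pt: "0 < p" "p \<le> t" "0 < t" "q \<le> 2 * t" using z bounds[OF z] by (auto simp: p_def t_def q_def)
      have "v_log z = p * ln (2 / p)" by (simp add: v_log_def p_def)
      also have "\<dots> \<le> p * ln (4 / p)" using pt by (intro mult_left_mono ln_mono divide_right_mono) auto
      also have "\<dots> \<le> p * (L + q / p)"
        using ln_le_add_ratio[of 4 p q] pt q by (intro mult_left_mono) (auto simp: L_def)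
      also have "\<dots> = p * L + q * 1" using pt by (simp add: field_simps)
      also have "\<dots> \<le> t * L + (2 * t) * L"
        using pt q L by (intro add_mono mult_mono) auto
      finally have "v_log z \<le> 3 * t * L" by (simp add: mult_ac)
      then have "v_log z * (q / (t\<^sup>2 * L)) \<le> 3 * t * L * (2 * t / (t\<^sup>2 * L))"
        using pt L q v_log_nonneg[OF z] by (intro mult_mono divide_right_mono) auto
      also have "\<dots> = 6" using pt L by (simp add: power2_eq_square)
      finally show ?thesis by (simp add: f''[OF z] t_def)
    qed
    moreover note f0
    moreover have "cmod (deriv f 0) \<le> 1"
    proof -
      have "cmod (deriv f 0) = cmod b / L" using f'[of 0] L by (simp add: h_def norm_divide)
      also have "\<dots> \<le> 1" using b L by simp
      finally show ?thesis .
    qed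
    ultimately have "zygmund_norm v_log f \<le> ennreal 7"
      using fh by (subst zygmund_norm_le_iff[OF v_log_nonneg]) force+
    moreover have "deriv f b = 0" using f'[OF b] by (simp add: h_def)
    moreover have "1 \<le> 4 * v_log b * cmod (deriv (deriv f) b)"
    proof -
      define s where "s = 1 - cmod b"
      have s: "0 < s" "s \<le> 1" using b by (auto simp: s_def)
      have qs: "q = s * (1 + cmod b)" by (simp add: q_def s_def power2_eq_square algebra_simps)
      have "s * 1 \<le> s * (1 + cmod b)" "s * (1 + cmod b) \<le> s * 2"
        using s b by (intro mult_left_mono; simp)+
      then have "s \<le> q" "q \<le> 2 * s" unfolding qs by simp_all
      have "L \<le> ln (2 / s * 2)"
        unfolding L_def using \<open>s \<le> q\<close> s q by (intro ln_mono) (auto simp: field_simps)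
      also have "\<dots> = ln (2 / s) + ln 2" using s by (intro ln_mult_pos) auto
      also have "ln 2 \<le> ln (2 / s)" using s by (intro ln_mono) (auto simp: field_simps)
      finally have "L \<le> 2 * ln (2 / s)" by simp
      then have "q * L \<le> (2 * s) * (2 * ln (2 / s))"
        using \<open>q \<le> 2 * s\<close> s L by (intro mult_mono) auto
      also have "\<dots> = 4 * v_log b" by (simp add: v_log_def s_def)
      finally have "q * L \<le> 4 * v_log b" .
      moreover have "cmod (1 - cnj b * b) = q" using q by (simp flip: qc)
      ultimately show ?thesis 
        using q L by (simp add: f''[OF b] power2_eq_square field_simps)
    qed
    ultimately show ?thesis by blast
  qed
  then show thesis using that[of 7] by simp
qed

text \<open>
  For the function critical at \<open>\<phi> z\<close> the second derivative of the composition at \<open>z\<close> is the single term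
  containing \<open>(deriv \<phi> z)\<^sup>2\<close>.
\<close>

lemma deriv_square_bound_if_continuous:
  assumes \<phi>: "\<phi> holomorphic_on unit_disk" "\<phi> ` unit_disk \<subseteq> unit_disk"
    and cont: "continuous_on_zygmund v_log (comp_op \<phi>)"
  shows "\<exists>K\<ge>0. \<forall>z\<in>unit_disk. v_log z * (cmod (deriv \<phi> z))\<^sup>2 \<le> K * v_log (\<phi> z)"
proof -
  obtain M where "0 < M" and M: "\<And>b. b \<in> unit_disk \<Longrightarrow> \<exists>f. zygmund_norm v_log f \<le> ennreal M \<and>
       deriv f b = 0 \<and> 1 \<le> 4 * v_log b * cmod (deriv (deriv f) b)"
    using test_function_critical by metis
  obtain K where "0 < K" and K: "\<And>f z. zygmund_norm v_log f \<le> ennreal M \<Longrightarrow> z \<in> unit_disk \<Longrightarrow>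
       v_log z * cmod (deriv (deriv (f \<circ> \<phi>)) z) \<le> K"
    using deriv2_comp_bounded_if_continuous[OF \<phi> cont \<open>0 < M\<close>] by metis
  have "v_log z * (cmod (deriv \<phi> z))\<^sup>2 \<le> 4 * K * v_log (\<phi> z)" if z: "z \<in> unit_disk" for z
  proof -
    have b: "\<phi> z \<in> unit_disk" using \<phi>(2) z by blast
    obtain f where f: "zygmund_norm v_log f \<le> ennreal M" "deriv f (\<phi> z) = 0"
      "1 \<le> 4 * v_log (\<phi> z) * cmod (deriv (deriv f) (\<phi> z))"
      using M[OF b] by blast
    have fh: "f holomorphic_on unit_disk"
      using f(1) zygmund_norm_le_iff[OF v_log_nonneg less_imp_le[OF \<open>0 < M\<close>]] by auto
    have "v_log z * (cmod (deriv \<phi> z))\<^sup>2 * 1 \<le>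
        v_log z * (cmod (deriv \<phi> z))\<^sup>2 * (4 * v_log (\<phi> z) * cmod (deriv (deriv f) (\<phi> z)))"
      using f(3) v_log_nonneg[OF z] by (intro mult_left_mono) auto
    also have "\<dots> = 4 * v_log (\<phi> z) * (v_log z * cmod (deriv (deriv (f \<circ> \<phi>)) z))"
      unfolding deriv2_comp_disk[OF fh \<phi> z] f(2) by (simp add: norm_mult norm_power)
    also have "\<dots> \<le> 4 * v_log (\<phi> z) * K"
      using K[OF f(1) z] v_log_nonneg[OF b] by (intro mult_left_mono) auto
    finally show ?thesis by (simp add: algebra_simps)
  qed
  then show ?thesis using \<open>0 < K\<close> by (intro exI[of _ "4 * K"]) auto
qed

text \<open>
  The log-log function isolates \<open>deriv (deriv \<phi>) z\<close>. Its second derivative does not vanish at \<open>\<phi> z\<close>, but the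
  resulting term is already under control by the bound on \<open>(deriv \<phi> z)\<^sup>2\<close>.
\<close>

lemma deriv2_bound_if_continuous:
  assumes \<phi>: "\<phi> holomorphic_on unit_disk" "\<phi> ` unit_disk \<subseteq> unit_disk"
    and cont: "continuous_on_zygmund v_log (comp_op \<phi>)"
  shows "\<exists>K\<ge>0. \<forall>z\<in>unit_disk. v_log z * cmod (deriv (deriv \<phi>) z) \<le> K * w_log (\<phi> z)"
proof -
  obtain M where "0 < M" and M: "\<And>b. b \<in> unit_disk \<Longrightarrow> \<exists>f. zygmund_norm v_log f \<le> ennreal M \<and>
       cmod (deriv f b) = inverse (w_log b)"
    using test_function_loglog by metis
  obtain K where "0 < K" and K: "\<And>f z. zygmund_norm v_log f \<le> ennreal M \<Longrightarrow> z \<in> unit_disk \<Longrightarrow>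
       v_log z * cmod (deriv (deriv (f \<circ> \<phi>)) z) \<le> K"
    using deriv2_comp_bounded_if_continuous[OF \<phi> cont \<open>0 < M\<close>] by metis
  obtain K2 where "0 \<le> K2" and
    K2: "\<And>z. z \<in> unit_disk \<Longrightarrow> v_log z * (cmod (deriv \<phi> z))\<^sup>2 \<le> K2 * v_log (\<phi> z)"
    using deriv_square_bound_if_continuous[OF \<phi> cont] by blast
  have "v_log z * cmod (deriv (deriv \<phi>) z) \<le> (K + K2 * M) * w_log (\<phi> z)" if z: "z \<in> unit_disk" for z
  proof -
    have b: "\<phi> z \<in> unit_disk" using \<phi>(2) z by blast
    obtain f where f: "zygmund_norm v_log f \<le> ennreal M"
      "cmod (deriv f (\<phi> z)) = inverse (w_log (\<phi> z))"
      using M[OF b] by blast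
    have fh: "f holomorphic_on unit_disk" and bd: "cmod (f 0) + cmod (deriv f 0)
        + v_log (\<phi> z) * cmod (deriv (deriv f) (\<phi> z)) \<le> M"
      using f(1) b zygmund_norm_le_iff[OF v_log_nonneg less_imp_le[OF \<open>0 < M\<close>]] by auto
    have f2: "v_log (\<phi> z) * cmod (deriv (deriv f) (\<phi> z)) \<le> M"
      using bd norm_ge_zero[of "f 0"] norm_ge_zero[of "deriv f 0"] by linarith
    define A where "A = deriv (deriv f) (\<phi> z) * (deriv \<phi> z)\<^sup>2"
    have "v_log z * cmod A = (v_log z * (cmod (deriv \<phi> z))\<^sup>2) * cmod (deriv (deriv f) (\<phi> z))"
      by (simp add: A_def norm_mult norm_power)
    also have "\<dots> \<le> K2 * v_log (\<phi> z) * cmod (deriv (deriv f) (\<phi> z))"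
      using K2[OF z] by (intro mult_right_mono) auto
    also have "\<dots> \<le> K2 * M"
      unfolding mult.assoc using f2 \<open>0 \<le> K2\<close> by (intro mult_left_mono)
    finally have A: "v_log z * cmod A \<le> K2 * M" .
    have "v_log z * cmod (deriv (deriv \<phi>) z) * inverse (w_log (\<phi> z))
        = v_log z * cmod (deriv (deriv (f \<circ> \<phi>)) z - A)"
      unfolding deriv2_comp_disk[OF fh \<phi> z] A_def by (simp add: norm_mult f(2))
    also have "\<dots> \<le> v_log z * (cmod (deriv (deriv (f \<circ> \<phi>)) z) + cmod A)"
      using v_log_nonneg[OF z] by (intro mult_left_mono norm_triangle_ineq4)
    also have "\<dots> \<le> K + K2 * M" using K[OF f(1) z] A by (simp add: distrib_left)
    finally show ?thesis using w_log_pos[OF b] by (simp add: field_simps)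
  qed
  then show ?thesis using \<open>0 < K\<close> \<open>0 \<le> K2\<close> \<open>0 < M\<close> by (intro exI[of _ "K + K2 * M"]) auto
qed

theorem corollary5p1:
  fixes \<phi> :: "complex \<Rightarrow> complex"
  assumes "\<phi> holomorphic_on unit_disk"
    and "\<phi> ` unit_disk \<subseteq> unit_disk"
  shows "continuous_on_zygmund v_log (comp_op \<phi>) \<longleftrightarrow>
    max
      (SUP n\<in>(UNIV :: nat set).
         of_nat ((n + 2) * (n + 1)) * zygmund_norm v_log (J_op' (deriv \<phi>) (\<lambda>z. \<phi> z ^ n))
           / zygmund_norm w_log (\<lambda>z. z ^ (n + 2)))
      (SUP n\<in>{1 :: nat..}.
         of_nat (n + 1) * zygmund_norm v_log (I_op' (deriv \<phi>) (\<lambda>z. \<phi> z ^ n))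
           / zygmund_norm v_log (\<lambda>z. z ^ (n + 1)))
    < \<infinity>"
proof (simp only: max_less_iff_conj
    J_quotients_bounded_iff[OF assms moderate_weight_w_log v_log_nonneg]
    I_quotients_bounded_iff[OF assms moderate_weight_v_log v_log_nonneg], rule iffI)
  assume "continuous_on_zygmund v_log (comp_op \<phi>)"
  then show "(\<exists>K\<ge>0. \<forall>z\<in>unit_disk. v_log z * cmod (deriv (deriv \<phi>) z) \<le> K * w_log (\<phi> z)) \<and>
      (\<exists>K\<ge>0. \<forall>z\<in>unit_disk. v_log z * (cmod (deriv \<phi> z))\<^sup>2 \<le> K * v_log (\<phi> z))"
    using deriv2_bound_if_continuous[OF assms] deriv_square_bound_if_continuous[OF assms] by blast
next
  assume "(\<exists>K\<ge>0. \<forall>z\<in>unit_disk. v_log z * cmod (deriv (deriv \<phi>) z) \<le> K * w_log (\<phi> z)) \<and>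
      (\<exists>K\<ge>0. \<forall>z\<in>unit_disk. v_log z * (cmod (deriv \<phi> z))\<^sup>2 \<le> K * v_log (\<phi> z))"
  then obtain K1 K2 where
    "0 \<le> K1" "\<And>z. z \<in> unit_disk \<Longrightarrow> v_log z * cmod (deriv (deriv \<phi>) z) \<le> K1 * w_log (\<phi> z)"
    "0 \<le> K2" "\<And>z. z \<in> unit_disk \<Longrightarrow> v_log z * (cmod (deriv \<phi> z))\<^sup>2 \<le> K2 * v_log (\<phi> z)"
    by blast
  from comp_op_bounded[OF assms this] show "continuous_on_zygmund v_log (comp_op \<phi>)"
    using continuous_comp_op_if_bounded by metis
qed

end
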